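(* Fix $1/2<\alpha\le2/3$ and let $\omega^\alpha_+(x)=\frac{1}{|x|\,|\log|x||^\alpha}\chi_{B^+(0;1/3)}(x)$. For each integer $n\ge2$ define $\omega^n_+$ on $\mathbb{R}^2$ by $\omega^n_+(x)=0$ if $x_2<0$, and for $x_2\ge0$: $\omega^n_+(x)=\omega^\alpha_+(x)$ if $|x|>1/n$, and $\omega^n_+(x)=\frac{n}{|\log n|^\alpha}$ if $|x|\le1/n$. Then $\omega^n_+\to\omega^\alpha_+$ strongly in $L^2(\log L)^\kappa(\mathbb{R}^2)$ as $n\to\infty$, for every $0\le\kappa<\alpha-1/2$. Moreover, if $u^n_1$ denotes the first component of $K\ast\omega^n_+$, then \[\lim_{n\to\infty}\int_{\mathbb{R}^2}u^n_1|\omega^n_+|^2\,dx=+\infty.\]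
   Context: $B^+(0;1/3)=\{x\in\mathbb{R}^2:|x|<1/3,\ x_2>0\}$; $K(x)=\frac{x^\perp}{2\pi|x|^2}$, $(x_1,x_2)^\perp=(-x_2,x_1)$. For $\kappa\ge0$, $A_{2,\kappa}(s)=[s\log^\kappa(2+s)]^2$, $L^2(\log L)^\kappa=\{f\in L^1_{loc}:\int A_{2,\kappa}(|f|)<\infty\}$ with Luxemburg norm $\|f\|_{2,\kappa}=\inf\{k>0:\int A_{2,\kappa}(|f|/k)\le1\}$. *)

theory Defs
  imports "HOL-Analysis.Analysis"
begin

text \<open>Points of R^2 are modelled as pairs (x1, x2) :: real \<times> real, with the Euclidean
  norm and Lebesgue measure lborel.\<close>

definition Bplus :: "(real \<times> real) set" where
  "Bplus = {x. norm x < 1/3 \<and> snd x > 0}"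

definition perp :: "real \<times> real \<Rightarrow> real \<times> real" where
  "perp x = (- snd x, fst x)"

definition BS_kernel :: "real \<times> real \<Rightarrow> real \<times> real" where
  "BS_kernel x = (1 / (2 * pi * (norm x)\<^sup>2)) *\<^sub>R perp x"

definition BS_conv :: "(real \<times> real \<Rightarrow> real) \<Rightarrow> real \<times> real \<Rightarrow> real \<times> real" where
  "BS_conv w x = (\<integral>y. w y *\<^sub>R BS_kernel (x - y) \<partial>lborel)"

definition A2k :: "real \<Rightarrow> real \<Rightarrow> real" where
  "A2k \<kappa> s = (s * (ln (2 + s)) powr \<kappa>)\<^sup>2"

definition orlicz_modular :: "real \<Rightarrow> (real \<times> real \<Rightarrow> real) \<Rightarrow> ennreal" where
  "orlicz_modular \<kappa> f = (\<integral>\<^sup>+ x. ennreal (A2k \<kappa> \<bar>f x\<bar>) \<partial>lborel)"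

definition in_L2logL :: "real \<Rightarrow> (real \<times> real \<Rightarrow> real) \<Rightarrow> bool" where
  "in_L2logL \<kappa> f \<longleftrightarrow> f \<in> borel_measurable lborel
     \<and> (\<forall>K. compact K \<longrightarrow> set_integrable lborel K f)
     \<and> orlicz_modular \<kappa> f < \<infinity>"

definition lux_norm :: "real \<Rightarrow> (real \<times> real \<Rightarrow> real) \<Rightarrow> real" where
  "lux_norm \<kappa> f = Inf {k::real. k > 0 \<and> orlicz_modular \<kappa> (\<lambda>x. f x / k) \<le> 1}"

definition omega_plus :: "real \<Rightarrow> real \<times> real \<Rightarrow> real" where
  "omega_plus \<alpha> x = (if x \<in> Bplus then 1 / (norm x * \<bar>ln (norm x)\<bar> powr \<alpha>) else 0)"

definition omega_n :: "real \<Rightarrow> nat \<Rightarrow> real \<times> real \<Rightarrow> real" where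
  "omega_n \<alpha> n x =
     (if snd x < 0 then 0
      else if norm x > 1 / real n then omega_plus \<alpha> x
      else real n / \<bar>ln (real n)\<bar> powr \<alpha>)"

end

theory Submission
  imports Defs
begin

text \<open>
  Near the origin the velocity is dominated by the vorticity farther out: for \<open>|y| \<ge> 2|x|\<close> the
  kernel of the first velocity component is \<open>y\<^sub>2 / (2\<pi>|y|\<^sup>2)\<close> up to an error \<open>O(|x| / |y|\<^sup>2)\<close>,
  so on a sector around the vertical axis this part contributes at least a constant times
  \<open>\<integral> ds / (s |log s|\<^sup>\<alpha>)\<close>, which is of order \<open>|log |x||\<^bsup>1 - \<alpha>\<^esup>\<close>. Everything else is bounded
  uniformly in \<open>n\<close>, using only \<open>\<omega>\<^sup>n(y) \<le> 1 / |y|\<close>. Integrating against \<open>|\<omega>\<^sup>n|\<^sup>2\<close>, the main term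
  becomes \<open>\<integral> dr / (r |log r|\<^bsup>3\<alpha> - 1\<^esup>)\<close>, which diverges because \<open>3\<alpha> - 1 \<le> 1\<close>, while the bounded
  part stays bounded because \<open>2\<alpha> > 1\<close>. Strong convergence is dominated convergence for the
  modular, since \<open>|\<omega>\<^sup>n - \<omega>| \<le> \<omega>\<close> almost everywhere for \<open>n \<ge> 4\<close>.
\<close>

section \<open>Radial integrals over cones\<close>

text \<open>Dilation by \<open>r\<close> maps the part of the cone in the unit ball onto its part in
  the ball of radius \<open>r\<close>, and it multiplies Lebesgue measure by \<open>r\<close> to the
  power of the dimension.\<close>

lemma emeasure_cone_cball:
  fixes S :: "'a::euclidean_space set"
  assumes S: "S \<in> sets borel" and cone: "\<And>t x. t > 0 \<Longrightarrow> x \<in> S \<Longrightarrow> t *\<^sub>R x \<in> S" and r: "r > 0"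
  shows "emeasure lborel (S \<inter> cball 0 r) = ennreal (r ^ DIM('a)) * emeasure lborel (S \<inter> cball 0 1)"
proof -
  have eq: "S \<inter> cball 0 r = (\<lambda>x. r *\<^sub>R x + 0) ` (S \<inter> cball 0 1)"
  proof (intro equalityI subsetI)
    fix x assume x: "x \<in> S \<inter> cball 0 r"
    then have "(1/r) *\<^sub>R x \<in> S \<inter> cball 0 1" "x = r *\<^sub>R ((1/r) *\<^sub>R x) + 0"
      using r cone[of "1/r" x] by (auto simp: field_simps)
    then show "x \<in> (\<lambda>x. r *\<^sub>R x + 0) ` (S \<inter> cball 0 1)" by blast
  next
    fix x assume "x \<in> (\<lambda>x. r *\<^sub>R x + 0) ` (S \<inter> cball 0 1)"
    then show "x \<in> S \<inter> cball 0 r" using r cone by (auto simp: mult_le_cancel_left1)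
  qed
  have b: "S \<inter> cball 0 r \<in> sets borel" "S \<inter> cball 0 1 \<in> sets borel" using S by auto
  have "emeasure lborel (S \<inter> cball 0 r) = emeasure lebesgue (S \<inter> cball 0 r)" using b by simp
  also have "\<dots> = ennreal (\<bar>r\<bar> ^ DIM('a)) * emeasure lebesgue (S \<inter> cball 0 1)"
    unfolding eq by (rule emeasure_lebesgue_affine)
  also have "\<dots> = ennreal (r ^ DIM('a)) * emeasure lborel (S \<inter> cball 0 1)" using b r by simp
  finally show ?thesis .
qed

text \<open>Polar coordinates without an angular variable. The image under \<open>norm\<close> of
  Lebesgue measure on \<open>S\<close> has distribution function c r^2, where c is the area of
  \<open>S\<close> in the unit disk, and this is also the distribution function of the density 2 c r
  on the positive half-line.\<close>

lemma nn_integral_cone_radial: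
  fixes S :: "(real \<times> real) set" and f :: "real \<Rightarrow> ennreal"
  assumes S[measurable]: "S \<in> sets borel"
    and cone: "\<And>t x. t > 0 \<Longrightarrow> x \<in> S \<Longrightarrow> t *\<^sub>R x \<in> S"
    and f[measurable]: "f \<in> borel_measurable borel"
  shows "(\<integral>\<^sup>+x. f (norm x) * indicator S x \<partial>lborel) =
    2 * emeasure lborel (S \<inter> cball 0 1) * (\<integral>\<^sup>+r. ennreal r * f r * indicator {0<..} r \<partial>lborel)"
proof -
  define c where "c = emeasure lborel (S \<inter> cball 0 1)"
  have c_fin: "c < \<infinity>"
    unfolding c_def by (intro emeasure_bounded_finite) (auto intro: bounded_subset[OF bounded_cball])
  define M where "M = distr (density lborel (indicator S)) borel (norm :: real \<times> real \<Rightarrow> real)"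
  define N where "N = density lborel (\<lambda>r::real. 2 * c * ennreal r * indicator {0<..} r)"
  have M_at: "emeasure M {..r} = (if r > 0 then ennreal (r^2) * c else 0)" for r
  proof -
    have "emeasure M {..r} = emeasure (density lborel (indicator S)) (cball 0 r)"
      unfolding M_def by (subst emeasure_distr) (auto intro!: arg_cong2[where f=emeasure])
    also have "\<dots> = emeasure lborel (S \<inter> cball 0 r)"
      by (subst emeasure_density) (auto simp: indicator_inter_arith[symmetric])
    finally have eq: "emeasure M {..r} = emeasure lborel (S \<inter> cball 0 r)" .
    show ?thesis
    proof (cases "r > 0")
      case True
      then show ?thesis using emeasure_cone_cball[OF S cone True] eq by (simp add: c_def power2_eq_square)
    next
      case False
      have "x = 0" if "norm x \<le> r" for x :: "real \<times> real"
        using that False norm_ge_zero[of x] by (metis norm_le_zero_iff not_less order_trans)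
      then have "S \<inter> cball 0 r \<subseteq> {0}" by auto
      then have "emeasure lborel (S \<inter> cball 0 r) \<le> emeasure lborel {0::real \<times> real}"
        by (intro emeasure_mono) auto
      then show ?thesis using eq False by simp
    qed
  qed
  have N_at: "emeasure N {..r} = (if r > 0 then ennreal (r^2) * c else 0)" for r
  proof (cases "r > 0")
    case True
    have "emeasure N {..r} = (\<integral>\<^sup>+x. c * (ennreal (2 * x) * indicator {0..r} x) \<partial>lborel)"
      unfolding N_def
      by (subst emeasure_density)
         (auto intro!: nn_integral_cong split: split_indicator simp: ennreal_mult mult_ac)
    also have "\<dots> = c * (\<integral>\<^sup>+x. ennreal (2 * x) * indicator {0..r} x \<partial>lborel)"
      by (rule nn_integral_cmult) measurable
    also have "(\<integral>\<^sup>+x. ennreal (2 * x) * indicator {0..r} x \<partial>lborel) = ennreal (r^2 - 0^2)"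
      by (rule nn_integral_FTC_Icc) (use True in \<open>auto intro!: derivative_eq_intros\<close>)
    finally show ?thesis using True by (simp add: mult.commute)
  next
    case False
    have "emeasure N {..r} = (\<integral>\<^sup>+x. 0 \<partial>(lborel :: real measure))"
      unfolding N_def
      by (subst emeasure_density)
         (use False in \<open>auto intro!: nn_integral_cong split: split_indicator simp del: nn_integral_const\<close>)
    then show ?thesis using False by simp
  qed
  \<comment> \<open>The half-lines \<open>{..a}\<close> are stable under intersection and generate
    the Borel sets, so finite agreement on them is enough.\<close>
  have "M = N"
  proof (rule measure_eqI_generator_eq[where E="range (\<lambda>a. {..a})" and \<Omega>=UNIV and A="\<lambda>i::nat. {..real i}"])
    show "Int_stable (range (\<lambda>a::real. {..a}))"
      by (auto simp: Int_stable_def)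
    show "(\<Union>i::nat. {..real i}) = UNIV" by (auto intro: real_arch_simple)
    show "emeasure M {..real i} \<noteq> \<infinity>" for i using c_fin M_at by (auto simp: ennreal_mult_eq_top_iff)
    show "sets M = sigma_sets UNIV (range (\<lambda>a. {..a}))"
         "sets N = sigma_sets UNIV (range (\<lambda>a. {..a}))"
      by (simp_all add: M_def N_def borel_eq_atMost)
  qed (auto simp: M_at N_at)
  have "(\<integral>\<^sup>+x. f (norm x) * indicator S x \<partial>lborel) = (\<integral>\<^sup>+r. f r \<partial>M)"
    unfolding M_def by (subst nn_integral_distr) (auto simp: nn_integral_density mult.commute)
  also have "\<dots> = (\<integral>\<^sup>+r. (2 * c) * (ennreal r * f r * indicator {0<..} r) \<partial>lborel)"
    unfolding \<open>M = N\<close> N_def by (subst nn_integral_density) (auto simp: mult_ac)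
  also have "\<dots> = 2 * c * (\<integral>\<^sup>+r. ennreal r * f r * indicator {0<..} r \<partial>lborel)"
    by (rule nn_integral_cmult) measurable
  finally show ?thesis unfolding c_def .
qed

text \<open>This is the number pi, kept as a symbol; the factor \<open>2 * unit_disk_area\<close> in
  front of radial integrals is the full angle.\<close>

definition unit_disk_area :: real where
  "unit_disk_area = measure lborel (cball (0 :: real \<times> real) 1)"

lemma unit_disk_area_nonneg: "unit_disk_area \<ge> 0"
  by (simp add: unit_disk_area_def)

lemma nn_integral_radial:
  fixes f :: "real \<Rightarrow> ennreal"
  assumes [measurable]: "f \<in> borel_measurable borel"
  shows "(\<integral>\<^sup>+x. f (norm (x :: real \<times> real)) \<partial>lborel) =
    ennreal (2 * unit_disk_area) * (\<integral>\<^sup>+r. ennreal r * f r * indicator {0<..} r \<partial>lborel)"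
proof -
  have "emeasure lborel (cball (0 :: real \<times> real) 1) = ennreal unit_disk_area"
    unfolding unit_disk_area_def
    by (intro emeasure_eq_ennreal_measure less_imp_neq emeasure_bounded_finite[unfolded infinity_ennreal_def]) auto
  then show ?thesis
    using nn_integral_cone_radial[of UNIV f] by (simp add: ennreal_mult unit_disk_area_nonneg)
qed

text \<open>After translating \<open>a\<close> to the origin, the Jacobian r cancels the singularity
  1/r and leaves the length of (0, R].\<close>

lemma nn_integral_inverse_norm_cball:
  fixes a :: "real \<times> real"
  assumes "R \<ge> 0"
  shows "(\<integral>\<^sup>+y. ennreal (1 / norm (y - a)) * indicator (cball a R) y \<partial>lborel)
    = ennreal (2 * unit_disk_area * R)"
proof -
  have "(\<integral>\<^sup>+y. ennreal (1 / norm (y - a)) * indicator (cball a R) y \<partial>lborel) =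
    (\<integral>\<^sup>+y. ennreal (1 / norm (y - a)) * indicator {..R} (norm (y - a)) \<partial>lborel)"
    by (intro nn_integral_cong) (auto simp: dist_norm norm_minus_commute split: split_indicator)
  also have "\<dots> = (\<integral>\<^sup>+y. ennreal (1 / norm y) * indicator {..R} (norm y) \<partial>distr lborel borel (\<lambda>y. - a + y))"
    by (subst nn_integral_distr) (auto simp: add.commute)
  also have "\<dots> = (\<integral>\<^sup>+y. ennreal (1 / norm (y::real\<times>real)) * indicator {..R} (norm y) \<partial>lborel)"
    by (subst lborel_distr_plus) simp
  also have "\<dots> = ennreal (2 * unit_disk_area) *
      (\<integral>\<^sup>+r. ennreal r * (ennreal (1 / r) * indicator {..R} r) * indicator {0<..} r \<partial>lborel)"
    by (rule nn_integral_radial) measurable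
  also have "(\<integral>\<^sup>+r. ennreal r * (ennreal (1 / r) * indicator {..R} r) * indicator {0<..} r \<partial>lborel)
      = (\<integral>\<^sup>+r. indicator {0<..R} r \<partial>lborel)"
    by (intro nn_integral_cong) (auto split: split_indicator simp flip: ennreal_mult)
  also have "\<dots> = ennreal R" using assms by simp
  finally show ?thesis using assms unit_disk_area_nonneg by (simp add: ennreal_mult)
qed

text \<open>The Jacobian reduces the integrand to 1/r^2, with primitive -1/r.\<close>

lemma nn_integral_inverse_norm_cube:
  assumes "R > 0"
  shows "(\<integral>\<^sup>+y. ennreal (1 / norm (y::real \<times> real) ^ 3) * indicator {R..} (norm y) \<partial>lborel)
    = ennreal (2 * unit_disk_area / R)"
proof -
  have "(\<integral>\<^sup>+y. ennreal (1 / norm (y::real \<times> real) ^ 3) * indicator {R..} (norm y) \<partial>lborel)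
    = ennreal (2 * unit_disk_area) *
      (\<integral>\<^sup>+r. ennreal r * (ennreal (1 / r ^ 3) * indicator {R..} r) * indicator {0<..} r \<partial>lborel)"
    by (rule nn_integral_radial) measurable
  also have "(\<integral>\<^sup>+r. ennreal r * (ennreal (1 / r ^ 3) * indicator {R..} r) * indicator {0<..} r \<partial>lborel)
     = (\<integral>\<^sup>+r. ennreal (1 / r ^ 2) * indicator {R..} r \<partial>lborel)"
    using assms
    by (intro nn_integral_cong)
       (auto split: split_indicator simp: power2_eq_square power3_eq_cube simp flip: ennreal_mult)
  also have "\<dots> = ennreal (0 - (- 1 / R))"
  proof (rule nn_integral_FTC_atLeast)
    show "((\<lambda>r::real. - 1 / r) has_real_derivative 1 / x ^ 2) (at x)" if "R \<le> x" for x
      using that assms by (auto intro!: derivative_eq_intros simp: power2_eq_square)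
    show "((\<lambda>r::real. - 1 / r) \<longlongrightarrow> 0) at_top"
      by (intro tendsto_divide_0[OF tendsto_const] filterlim_at_top_imp_at_infinity filterlim_ident)
  qed auto
  finally show ?thesis using assms unit_disk_area_nonneg by (simp flip: ennreal_mult)
qed

text \<open>The radial integrand is 1/(r |ln r|^p). Its primitive |ln r|^(1-p)/(p-1) tends to 0 at
  the origin because p > 1, so the improper integral converges.\<close>

lemma nn_integral_inverse_log_finite:
  assumes "p > 1"
  shows "(\<integral>\<^sup>+x. ennreal (1 / (norm x ^ 2 * \<bar>ln (norm (x::real \<times> real))\<bar> powr p)) *
    indicator {..<1/3} (norm x) \<partial>lborel) < \<infinity>"
proof -
  let ?f = "\<lambda>r::real. 1 / (r * (- ln r) powr p)"
  have ln_neg: "ln r < 0" if "0 < r" "r < 1/3" for r :: real using that by simp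
  have "set_integrable lborel (einterval (ereal 0) (ereal (1/3))) ?f"
  proof (rule interval_integral_FTC_nonneg(1))
    show "((\<lambda>r. (- ln r) powr (1 - p) / (p - 1)) has_real_derivative ?f r) (at r)"
      if "ereal 0 < ereal r" "ereal r < ereal (1/3)" for r
    proof -
      have r: "0 < r" "0 < - ln r" using that ln_neg[of r] by auto
      then have "((\<lambda>r. - ln r) has_real_derivative - (1 / r)) (at r)"
        by (auto intro!: derivative_eq_intros)
      from DERIV_cdivide[OF DERIV_fun_powr[OF this r(2), of "1 - p"], of "p - 1"]
      have "((\<lambda>r. (- ln r) powr (1 - p) / (p - 1)) has_real_derivative
          (1 - p) * (- ln r) powr (1 - p - of_nat 1) * - (1 / r) / (p - 1)) (at r)" .
      moreover have "(1 - p) * (- ln r) powr (1 - p - of_nat 1) * - (1 / r) / (p - 1) = ?f r"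
        using assms by (simp add: powr_minus divide_simps)
      ultimately show ?thesis by simp
    qed
    show "isCont ?f r" if "ereal 0 < ereal r" "ereal r < ereal (1/3)" for r
      using that ln_neg[of r] by (auto intro!: continuous_intros)
    show "AE x in lborel. ereal 0 < ereal x \<longrightarrow> ereal x < ereal (1/3) \<longrightarrow> 0 \<le> ?f x"
      by auto
    have "((\<lambda>r. (- ln r) powr (1 - p) / (p - 1)) \<longlongrightarrow> 0 / (p - 1)) (at_right 0)"
    proof (intro tendsto_divide tendsto_neg_powr tendsto_const)
      show "filterlim (\<lambda>x::real. - ln x) at_top (at_right 0)"
        by (simp add: filterlim_uminus_at_top ln_at_0)
    qed (use assms in auto)
    then show "(((\<lambda>r. (- ln r) powr (1 - p) / (p - 1)) \<circ> real_of_ereal) \<longlongrightarrow> 0) (at_right (ereal 0))"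
      by (subst ereal_tendsto_simps1) simp
    have "((\<lambda>r. (- ln r) powr (1 - p) / (p - 1)) \<longlongrightarrow> (- ln (1/3)) powr (1 - p) / (p - 1)) (at_left (1/3))"
      using assms by (intro tendsto_intros) auto
    then show "(((\<lambda>r. (- ln r) powr (1 - p) / (p - 1)) \<circ> real_of_ereal) \<longlongrightarrow>
        (- ln (1/3)) powr (1 - p) / (p - 1)) (at_left (ereal (1/3)))"
      by (subst ereal_tendsto_simps1) simp
  qed auto
  then have "(\<integral>\<^sup>+r. ennreal (norm (indicator {0<..<1/3} r *\<^sub>R ?f r)) \<partial>lborel) < \<infinity>"
    by (simp add: set_integrable_def integrable_iff_bounded)
  also have "(\<integral>\<^sup>+r. ennreal (norm (indicator {0<..<1/3} r *\<^sub>R ?f r)) \<partial>lborel) =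
     (\<integral>\<^sup>+r. ennreal r * (ennreal (1 / (r ^ 2 * \<bar>ln r\<bar> powr p)) * indicator {..<1/3} r) * indicator {0<..} r \<partial>lborel)"
    by (intro nn_integral_cong)
      (auto split: split_indicator simp: power2_eq_square simp flip: ennreal_mult)
  finally have fin: "\<dots> < \<infinity>" .
  have "(\<integral>\<^sup>+x. ennreal (1 / (norm x ^ 2 * \<bar>ln (norm (x::real \<times> real))\<bar> powr p)) *
    indicator {..<1/3} (norm x) \<partial>lborel) = ennreal (2 * unit_disk_area) *
     (\<integral>\<^sup>+r. ennreal r * (ennreal (1 / (r ^ 2 * \<bar>ln r\<bar> powr p)) * indicator {..<1/3} r) * indicator {0<..} r \<partial>lborel)"
    by (rule nn_integral_radial) measurable
  also have "\<dots> < \<infinity>" using fin by (simp add: ennreal_mult_less_top)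
  finally show ?thesis .
qed

section \<open>The sector around the positive vertical axis\<close>

text \<open>Directions within angle pi/3 of the vertical axis, together with the origin. Away from
  the origin, snd y / |y|^2 is at least 1/(2|y|) there.\<close>

definition upper_sector :: "(real \<times> real) set" where
  "upper_sector = {x. norm x \<le> 2 * snd x}"

definition upper_sector_area :: real where
  "upper_sector_area = measure lborel (upper_sector \<inter> cball 0 1)"

lemma upper_sector_measurable[measurable]: "upper_sector \<in> sets borel"
proof -
  have "closed upper_sector"
    unfolding upper_sector_def by (intro closed_Collect_le continuous_intros)
  then show ?thesis by (rule borel_closed)
qed

lemma emeasure_upper_sector: "emeasure lborel (upper_sector \<inter> cball 0 1) = ennreal upper_sector_area"
  unfolding upper_sector_area_def
  by (intro emeasure_eq_ennreal_measure less_imp_neq emeasure_bounded_finite[unfolded infinity_ennreal_def])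
     (auto intro: bounded_subset[OF bounded_cball])

lemma upper_sector_area_pos: "upper_sector_area > 0"
proof -
  \<comment> \<open>In the ball of radius 1/6 about this point the height exceeds 1/3 and the norm
    stays below 2/3, which is exactly the sector condition.\<close>
  let ?a = "(0, 1/2) :: real \<times> real"
  have sub: "ball ?a (1/6) \<subseteq> upper_sector \<inter> cball 0 1"
  proof
    fix x assume "x \<in> ball ?a (1/6)"
    then have d: "norm (x - ?a) < 1/6" by (simp add: dist_norm norm_minus_commute)
    have "\<bar>snd (x - ?a)\<bar> \<le> norm (x - ?a)" by (metis real_norm_def norm_snd_le prod.collapse)
    moreover have "norm x \<le> norm ?a + norm (x - ?a)" by (metis norm_triangle_sub add.commute)
    moreover have "norm ?a = 1/2" by (simp add: norm_Pair)
    ultimately show "x \<in> upper_sector \<inter> cball 0 1" using d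
      by (auto simp: upper_sector_def)
  qed
  have "0 < measure lborel (ball ?a (1/6))" using content_ball_pos[of "1/6" ?a] by simp
  also have "\<dots> \<le> upper_sector_area" unfolding upper_sector_area_def
    using sub by (intro measure_mono_fmeasurable) (auto simp: fmeasurable_def emeasure_upper_sector)
  finally show ?thesis .
qed

lemma nn_integral_upper_sector_radial:
  fixes f :: "real \<Rightarrow> ennreal"
  assumes [measurable]: "f \<in> borel_measurable borel"
  shows "(\<integral>\<^sup>+x. f (norm (x :: real \<times> real)) * indicator upper_sector x \<partial>lborel) =
    ennreal (2 * upper_sector_area) * (\<integral>\<^sup>+r. ennreal r * f r * indicator {0<..} r \<partial>lborel)"
proof -
  have "t *\<^sub>R x \<in> upper_sector" if "t > 0" "x \<in> upper_sector" for t x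
    using that by (simp add: upper_sector_def)
  from nn_integral_cone_radial[OF upper_sector_measurable this assms] show ?thesis
    using upper_sector_area_pos by (simp add: ennreal_mult emeasure_upper_sector)
qed

lemma nn_integral_upper_sector_inverse_square:
  assumes "0 < a" "a \<le> b"
  shows "(\<integral>\<^sup>+x. ennreal (1 / norm x ^ 2) * indicator {a..b} (norm x) * indicator upper_sector x \<partial>lborel)
    = ennreal (2 * upper_sector_area * (ln b - ln a))"
proof -
  have "(\<integral>\<^sup>+x. ennreal (1 / norm x ^ 2) * indicator {a..b} (norm x) * indicator upper_sector x \<partial>lborel)
    = ennreal (2 * upper_sector_area) *
     (\<integral>\<^sup>+r. ennreal r * (ennreal (1 / r ^ 2) * indicator {a..b} r) * indicator {0<..} r \<partial>lborel)"
    by (rule nn_integral_upper_sector_radial) measurable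
  also have "(\<integral>\<^sup>+r. ennreal r * (ennreal (1 / r ^ 2) * indicator {a..b} r) * indicator {0<..} r \<partial>lborel)
    = (\<integral>\<^sup>+r. ennreal (1 / r) * indicator {a..b} r \<partial>lborel)"
    using assms
    by (intro nn_integral_cong) (auto split: split_indicator simp: power2_eq_square simp flip: ennreal_mult)
  also have "\<dots> = ennreal (ln b - ln a)"
    using assms by (intro nn_integral_FTC_Icc) (auto intro!: derivative_eq_intros)
  finally show ?thesis using assms upper_sector_area_pos by (simp flip: ennreal_mult)
qed

text \<open>The Jacobian leaves 1/(r |ln r|), with primitive -ln(-ln r). This double logarithm is
  what finally diverges.\<close>

lemma nn_integral_upper_sector_inverse_log:
  assumes "0 < a" "a \<le> b" "b < 1"
  shows "(\<integral>\<^sup>+x. ennreal (1 / (norm x ^ 2 * \<bar>ln (norm x)\<bar>)) * indicator {a..b} (norm x) * indicator upper_sector x \<partial>lborel)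
    = ennreal (2 * upper_sector_area * (ln (- ln a) - ln (- ln b)))"
proof -
  have "(\<integral>\<^sup>+x. ennreal (1 / (norm x ^ 2 * \<bar>ln (norm x)\<bar>)) * indicator {a..b} (norm x) * indicator upper_sector x \<partial>lborel)
    = ennreal (2 * upper_sector_area) *
     (\<integral>\<^sup>+r. ennreal r * (ennreal (1 / (r ^ 2 * \<bar>ln r\<bar>)) * indicator {a..b} r) * indicator {0<..} r \<partial>lborel)"
    by (rule nn_integral_upper_sector_radial) measurable
  also have "(\<integral>\<^sup>+r. ennreal r * (ennreal (1 / (r ^ 2 * \<bar>ln r\<bar>)) * indicator {a..b} r) * indicator {0<..} r \<partial>lborel)
    = (\<integral>\<^sup>+r. ennreal (1 / (r * - ln r)) * indicator {a..b} r \<partial>lborel)"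
  proof (intro nn_integral_cong)
    fix r :: real
    show "ennreal r * (ennreal (1 / (r ^ 2 * \<bar>ln r\<bar>)) * indicator {a..b} r) * indicator {0<..} r
        = ennreal (1 / (r * - ln r)) * indicator {a..b} r"
    proof (cases "r \<in> {a..b}")
      case True
      then have "0 < r" "ln r < 0" using assms by auto
      then have "ennreal r * ennreal (1 / (r ^ 2 * \<bar>ln r\<bar>)) = ennreal (1 / (r * - ln r))"
        by (subst ennreal_mult[symmetric]) (auto simp: power2_eq_square mult_nonneg_nonpos)
      then show ?thesis using True \<open>0 < r\<close> by simp
    qed auto
  qed
  also have "\<dots> = ennreal (- ln (- ln b) - - ln (- ln a))"
  proof (rule nn_integral_FTC_Icc)
    fix x assume x: "x \<in> {a..b}"
    then have "0 < x" "ln x < 0" using assms by auto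
    then show "((\<lambda>r. - ln (- ln r)) has_real_derivative 1 / (x * - ln x)) (at x)"
      by (auto intro!: derivative_eq_intros simp: field_simps)
    show "0 \<le> 1 / (x * - ln x)" using \<open>0 < x\<close> \<open>ln x < 0\<close> by (simp add: mult_le_0_iff)
  qed (use assms in auto)
  finally show ?thesis using assms upper_sector_area_pos by (simp flip: ennreal_mult)
qed

section \<open>The vorticities and the Orlicz modular\<close>

text \<open>Since e \<le> 3. With this bound, nonnegative powers of the logarithm are at least 1 on
  the disk of radius 1/3.\<close>

lemma abs_ln_ge_1:
  fixes r :: real
  assumes "0 < r" "r \<le> 1/3"
  shows "\<bar>ln r\<bar> \<ge> 1" "ln r < 0"
proof -
  have "ln 3 \<ge> (1::real)" using exp_le by (simp add: ln_ge_iff)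
  moreover have "ln r \<le> ln (1/3)" using assms by (subst ln_le_cancel_iff) auto
  ultimately show "\<bar>ln r\<bar> \<ge> 1" "ln r < 0" by (auto simp: ln_div)
qed

text \<open>Write b = t a with t \<ge> 1. From ln t \<le> t - 1 and |ln b| \<ge> 1 follows |ln a|
  \<le> t |ln b|, and t^\<alpha> \<le> t because \<alpha> \<le> 1. Consequently the profile of
  \<open>omega_plus\<close> decreases with the radius.\<close>

lemma mult_abs_ln_powr_mono:
  fixes a b \<alpha> :: real
  assumes "0 < a" "a \<le> b" "b \<le> 1/3" "0 \<le> \<alpha>" "\<alpha> \<le> 1"
  shows "a * \<bar>ln a\<bar> powr \<alpha> \<le> b * \<bar>ln b\<bar> powr \<alpha>"
proof -
  define t where "t = b / a"
  have t: "t \<ge> 1" "b = t * a" using assms by (auto simp: t_def)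
  have b: "\<bar>ln b\<bar> \<ge> 1" "ln b < 0" using abs_ln_ge_1[of b] assms by auto
  have a: "ln a < 0" using abs_ln_ge_1[of a] assms by auto
  have "ln t = ln b - ln a" using assms by (simp add: t_def ln_div)
  then have "\<bar>ln a\<bar> = \<bar>ln b\<bar> + ln t" using a b(2) by simp
  also have "\<dots> \<le> \<bar>ln b\<bar> + \<bar>ln b\<bar> * (t - 1)"
    using b(1) t(1) ln_le_minus_one[of t] mult_mono[of 1 "\<bar>ln b\<bar>" "ln t" "t - 1"] by simp
  also have "\<dots> = \<bar>ln b\<bar> * t" by (simp add: algebra_simps)
  finally have "\<bar>ln a\<bar> powr \<alpha> \<le> (\<bar>ln b\<bar> * t) powr \<alpha>"
    using assms by (intro powr_mono2) auto
  also have "\<dots> = \<bar>ln b\<bar> powr \<alpha> * t powr \<alpha>" by (rule powr_mult)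
  also have "\<dots> \<le> \<bar>ln b\<bar> powr \<alpha> * t"
    using t(1) assms(5) powr_mono[of \<alpha> 1 t] by (intro mult_left_mono) auto
  finally have "a * \<bar>ln a\<bar> powr \<alpha> \<le> a * (\<bar>ln b\<bar> powr \<alpha> * t)"
    using assms by (intro mult_left_mono) auto
  then show ?thesis unfolding t(2) by (simp add: mult_ac)
qed

lemma Bplus_measurable[measurable]: "Bplus \<in> sets borel"
proof -
  have "open Bplus"
    unfolding Bplus_def by (intro open_Collect_conj open_Collect_less continuous_intros)
  then show ?thesis by (rule borel_open)
qed

lemma omega_plus_measurable[measurable]: "omega_plus \<alpha> \<in> borel_measurable borel"
  unfolding omega_plus_def[abs_def] by measurable

lemma omega_n_measurable[measurable]: "omega_n \<alpha> n \<in> borel_measurable borel"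
proof -
  have "{x :: real \<times> real. snd x < 0} \<in> sets borel"
    by (intro borel_open open_Collect_less continuous_intros)
  then have [measurable]: "Measurable.pred borel (\<lambda>x :: real \<times> real. snd x < 0)"
    by (simp add: pred_def)
  show ?thesis unfolding omega_n_def[abs_def] by measurable
qed

lemma omega_plus_nonneg: "omega_plus \<alpha> x \<ge> 0"
  by (simp add: omega_plus_def)

lemma omega_n_nonneg: "omega_n \<alpha> n x \<ge> 0"
  by (simp add: omega_n_def omega_plus_nonneg)

lemma Bplus_norm: "x \<in> Bplus \<Longrightarrow> 0 < norm x \<and> norm x < 1/3"
  by (auto simp: Bplus_def)

lemma omega_plus_le_inverse_norm:
  assumes "\<alpha> \<ge> 0"
  shows "omega_plus \<alpha> x \<le> 1 / norm x"
proof (cases "x \<in> Bplus")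
  case True
  then have x: "0 < norm x" "norm x < 1/3" using Bplus_norm by auto
  then have "1 \<le> \<bar>ln (norm x)\<bar> powr \<alpha>"
    using abs_ln_ge_1[of "norm x"] assms by (intro ge_one_powr_ge_zero) auto
  then have "norm x \<le> norm x * \<bar>ln (norm x)\<bar> powr \<alpha>"
    using x(1) by (simp add: mult_le_cancel_left1)
  then have "1 / (norm x * \<bar>ln (norm x)\<bar> powr \<alpha>) \<le> 1 / norm x"
    using x(1) by (intro frac_le) simp_all
  then show ?thesis using True by (simp add: omega_plus_def)
qed (simp add: omega_plus_def)

text \<open>On the inner disk the constant value is at most n, hence at most 1/|x|. The bound does
  not depend on \<open>n\<close>, which makes the velocity errors below uniform.\<close>

lemma omega_n_le_inverse_norm:
  assumes "\<alpha> \<ge> 0" "n \<ge> 3" "x \<noteq> 0"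
  shows "omega_n \<alpha> n x \<le> 1 / norm x"
proof -
  have n: "\<bar>ln (real n)\<bar> \<ge> 1"
    using abs_ln_ge_1[of "1 / real n"] assms by (simp add: ln_div field_simps)
  then have "1 \<le> \<bar>ln (real n)\<bar> powr \<alpha>" using assms by (intro ge_one_powr_ge_zero) auto
  then have "real n / \<bar>ln (real n)\<bar> powr \<alpha> \<le> real n / 1"
    by (intro divide_left_mono) auto
  moreover have "real n \<le> 1 / norm x" if "norm x \<le> 1 / real n"
    using that assms by (simp add: field_simps)
  ultimately show ?thesis
    using omega_plus_le_inverse_norm[OF assms(1), of x] by (auto simp: omega_n_def)
qed

text \<open>The constant on the inner half-disk is the value of the decreasing radial profile at
  radius 1/n. For n \<ge> 4 this half-disk lies in \<open>Bplus\<close>. The line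
  \<open>snd x = 0\<close> is excluded because near the origin \<open>omega_n\<close> is positive on
  it, while \<open>omega_plus\<close> vanishes.\<close>

lemma omega_n_le_omega_plus:
  assumes "0 \<le> \<alpha>" "\<alpha> \<le> 1" "n \<ge> 4" "snd x \<noteq> 0"
  shows "omega_n \<alpha> n x \<le> omega_plus \<alpha> x"
proof (cases "snd x > 0 \<and> norm x \<le> 1 / real n")
  case True
  have n: "1 / real n \<le> 1/4" using assms by (simp add: field_simps)
  have x: "norm x > 0" using True by auto
  have "x \<in> Bplus" using True n by (auto simp: Bplus_def)
  have "norm x * \<bar>ln (norm x)\<bar> powr \<alpha> \<le> (1 / real n) * \<bar>ln (1 / real n)\<bar> powr \<alpha>"
    using True n x assms by (intro mult_abs_ln_powr_mono) auto
  also have "\<bar>ln (1 / real n)\<bar> = \<bar>ln (real n)\<bar>" using assms by (simp add: ln_div)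
  finally have le: "norm x * \<bar>ln (norm x)\<bar> powr \<alpha> \<le> (1 / real n) * \<bar>ln (real n)\<bar> powr \<alpha>" .
  have "ln (norm x) \<noteq> 0" using abs_ln_ge_1(2)[of "norm x"] True n x by linarith
  then have "0 < norm x * \<bar>ln (norm x)\<bar> powr \<alpha>" using x by simp
  from divide_left_mono[OF le _ mult_pos_pos[OF less_le_trans[OF this le] this], of 1]
  have "1 / ((1 / real n) * \<bar>ln (real n)\<bar> powr \<alpha>) \<le> 1 / (norm x * \<bar>ln (norm x)\<bar> powr \<alpha>)"
    by (simp add: mult.commute)
  then show ?thesis using True \<open>x \<in> Bplus\<close> by (simp add: omega_n_def omega_plus_def)
next
  case False
  then consider "snd x < 0" | "norm x > 1 / real n" using assms(4) by linarith
  then show ?thesis by cases (simp_all add: omega_n_def omega_plus_nonneg)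
qed

lemma omega_n_support:
  assumes "n \<ge> 2" "norm x > 1/2"
  shows "omega_n \<alpha> n x = 0"
proof -
  have "1 / real n \<le> 1/2" using assms by (simp add: field_simps)
  then have "1 / real n < norm x" using assms by linarith
  then show ?thesis using assms(2) by (simp add: omega_n_def omega_plus_def Bplus_def)
qed

lemma omega_n_bounded:
  assumes "\<alpha> \<ge> 0" "n \<ge> 2"
  obtains M where "M \<ge> 0" "\<And>x. omega_n \<alpha> n x \<le> M * indicator (cball 0 (1/2)) x"
proof
  \<comment> \<open>The first summand bounds the outer part through 1/|x| < n, the second is the
    value on the inner disk.\<close>
  let ?M = "real n + real n / \<bar>ln (real n)\<bar> powr \<alpha>"
  show "?M \<ge> 0" by simp
  fix x
  show "omega_n \<alpha> n x \<le> ?M * indicator (cball 0 (1/2)) x"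
  proof (cases "norm x > 1/2")
    case True
    then show ?thesis using omega_n_support[OF assms(2) True] by simp
  next
    case False
    have "omega_plus \<alpha> x \<le> real n" if "norm x > 1 / real n"
    proof -
      have "norm x > 0" using that le_less_trans[of 0 "1 / real n" "norm x"] by simp
      then have "1 / norm x \<le> real n" using that assms by (simp add: field_simps)
      then show ?thesis using omega_plus_le_inverse_norm[OF assms(1), of x] by simp
    qed
    then have "omega_plus \<alpha> x \<le> ?M" if "norm x > 1 / real n"
      using that by (intro add_increasing2) auto
    then show ?thesis using False by (auto simp: omega_n_def)
  qed
qed

text \<open>The horizontal axis is a hyperplane, hence null; this turns the comparison of
  \<open>omega_n\<close> with \<open>omega_plus\<close> into one almost everywhere.\<close>

lemma AE_lborel_snd_nonzero: "AE x :: real \<times> real in lborel. snd x \<noteq> 0"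
proof -
  have "negligible {x :: real \<times> real. (0, 1) \<bullet> x = 0}"
    by (intro negligible_hyperplane) (auto simp: zero_prod_def)
  moreover have "{x :: real \<times> real. (0, 1) \<bullet> x = 0} = {x. snd x = 0}"
    by (auto simp: inner_prod_def)
  ultimately have "{x :: real \<times> real. snd x = 0} \<in> null_sets lebesgue"
    by (simp add: negligible_iff_null_sets)
  moreover have "{x :: real \<times> real. snd x = 0} \<in> sets borel"
    by (intro borel_closed closed_Collect_eq continuous_intros)
  ultimately have "{x :: real \<times> real. snd x = 0} \<in> null_sets lborel"
    by (auto simp: null_sets_def)
  from AE_not_in[OF this] show ?thesis by simp
qed

section \<open>The Young function and the Orlicz modular\<close>

lemma A2k_measurable[measurable]: "A2k \<kappa> \<in> borel_measurable borel"
  unfolding A2k_def[abs_def] by measurable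

lemma A2k_mono:
  assumes "\<kappa> \<ge> 0" "0 \<le> s" "s \<le> t"
  shows "A2k \<kappa> s \<le> A2k \<kappa> t"
  unfolding A2k_def using assms
  by (intro power_mono mult_mono powr_mono2) auto

text \<open>A quantitative Delta_2 condition: ln (2 + s/e) \<le> ln (2 + s) + ln (1/e), and the last
  term is absorbed into the first because ln (2 + s) \<ge> ln 2. It keeps the modular of
  \<open>omega_plus\<close> finite after division by any small \<open>e\<close>.\<close>

lemma A2k_scale:
  assumes "\<kappa> \<ge> 0" "0 < e" "e \<le> 1" "0 \<le> s"
  shows "A2k \<kappa> (s / e) \<le> (1 / e * (1 + ln (1 / e) / ln 2) powr \<kappa>)\<^sup>2 * A2k \<kappa> s"
proof -
  have "2 * e + s \<le> 2 + s" using assms by simp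
  then have "2 + s / e \<le> (2 + s) * (1 / e)" using assms by (simp add: field_simps)
  then have "ln (2 + s / e) \<le> ln ((2 + s) * (1 / e))" using assms
    by (subst ln_le_cancel_iff) (auto simp: add_pos_nonneg)
  also have "\<dots> = ln (2 + s) + ln (1 / e)" using assms by (intro ln_mult_pos) auto
  also have "\<dots> \<le> ln (2 + s) + ln (1 / e) * (ln (2 + s) / ln 2)"
  proof -
    have "1 \<le> ln (2 + s) / ln 2" "0 \<le> ln (1 / e)" using assms by (auto simp: field_simps)
    then show ?thesis by (metis add_left_mono mult.right_neutral mult_left_mono)
  qed
  also have "\<dots> = (1 + ln (1 / e) / ln 2) * ln (2 + s)" by (simp add: field_simps)
  finally have "ln (2 + s / e) powr \<kappa> \<le> ((1 + ln (1 / e) / ln 2) * ln (2 + s)) powr \<kappa>"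
    using assms by (intro powr_mono2) auto
  also have "\<dots> = (1 + ln (1 / e) / ln 2) powr \<kappa> * ln (2 + s) powr \<kappa>"
    by (rule powr_mult)
  finally have "s / e * ln (2 + s / e) powr \<kappa> \<le>
      s / e * ((1 + ln (1 / e) / ln 2) powr \<kappa> * ln (2 + s) powr \<kappa>)"
    using assms by (intro mult_left_mono) auto
  also have "\<dots> = (1 / e * (1 + ln (1 / e) / ln 2) powr \<kappa>) * (s * ln (2 + s) powr \<kappa>)"
    by simp
  finally have "(s / e * ln (2 + s / e) powr \<kappa>)\<^sup>2 \<le>
      ((1 / e * (1 + ln (1 / e) / ln 2) powr \<kappa>) * (s * ln (2 + s) powr \<kappa>))\<^sup>2"
    using assms by (intro power_mono) auto
  then show ?thesis unfolding A2k_def power_mult_distrib by simp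
qed

text \<open>With r = |x|, the vorticity is at most 1/r and 2 + 1/r \<le> 1/r^2, so the logarithm in
  the Young function is at most 2 |ln r|. The weight thus lowers the logarithmic exponent from 2
  \<alpha> to 2 (\<alpha> - \<kappa>).\<close>

lemma A2k_omega_plus_le:
  assumes "\<kappa> \<ge> 0" "\<alpha> \<ge> 0" "x \<in> Bplus"
  shows "A2k \<kappa> (omega_plus \<alpha> x) \<le> 2 powr (2 * \<kappa>) *
     (1 / (norm x ^ 2 * \<bar>ln (norm x)\<bar> powr (2 * (\<alpha> - \<kappa>))))"
proof -
  define r where "r = norm x"
  define l where "l = \<bar>ln r\<bar>"
  have r: "0 < r" "r < 1/3" using Bplus_norm[OF assms(3)] by (auto simp: r_def)
  have l: "l \<ge> 1" "ln r = - l" using abs_ln_ge_1[of r] r by (auto simp: l_def)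
  have om: "omega_plus \<alpha> x = 1 / (r * l powr \<alpha>)" using assms by (simp add: omega_plus_def r_def l_def)
  \<comment> \<open>Since 2/9 + 1/3 < 1, the radius 1/3 is small enough for 2 + 1/r \<le>
    1/r^2.\<close>
  have "r * r \<le> (1/3) * (1/3)" using r by (intro mult_mono) auto
  then have "2 * (r * r) + r \<le> 1" using r by simp
  then have "(2 * (r * r) + r) / (r * r) \<le> 1 / (r * r)" by (intro divide_right_mono) auto
  then have "2 + 1 / r \<le> 1 / (r * r)" using r by (simp add: add_divide_distrib)
  moreover have "omega_plus \<alpha> x \<le> 1 / r" using omega_plus_le_inverse_norm[OF assms(2)] by (simp add: r_def)
  ultimately have "ln (2 + omega_plus \<alpha> x) \<le> ln (1 / (r * r))"
    using r omega_plus_nonneg[of \<alpha> x] by (subst ln_le_cancel_iff) auto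
  also have "\<dots> = 2 * l" using r l by (simp add: ln_div ln_mult)
  finally have "omega_plus \<alpha> x * ln (2 + omega_plus \<alpha> x) powr \<kappa> \<le> 1 / (r * l powr \<alpha>) * (2 * l) powr \<kappa>"
    using omega_plus_nonneg[of \<alpha> x] assms by (intro mult_mono powr_mono2) (auto simp: om)
  then have "A2k \<kappa> (omega_plus \<alpha> x) \<le> (1 / (r * l powr \<alpha>) * (2 * l) powr \<kappa>)\<^sup>2"
    unfolding A2k_def using omega_plus_nonneg[of \<alpha> x] by (intro power_mono) auto
  also have "\<dots> = 2 powr (2 * \<kappa>) * (1 / (r ^ 2 * l powr (2 * (\<alpha> - \<kappa>))))"
    using l r
    by (simp add: powr_mult power_mult_distrib power_divide powr_power powr_diff right_diff_distrib mult.commute)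
  finally show ?thesis by (simp add: r_def l_def)
qed

text \<open>The condition \<kappa> < \<alpha> - 1/2 says exactly that the logarithmic exponent 2
  (\<alpha> - \<kappa>) exceeds 1.\<close>

lemma orlicz_modular_omega_plus_finite:
  assumes "\<kappa> \<ge> 0" "\<alpha> \<ge> 0" "\<kappa> < \<alpha> - 1/2"
  shows "(\<integral>\<^sup>+x. ennreal (A2k \<kappa> (omega_plus \<alpha> x)) \<partial>lborel) < \<infinity>"
proof -
  let ?g = "\<lambda>x :: real \<times> real. ennreal (1 / (norm x ^ 2 * \<bar>ln (norm x)\<bar> powr (2 * (\<alpha> - \<kappa>)))) *
      indicator {..<1/3} (norm x)"
  have "ennreal (A2k \<kappa> (omega_plus \<alpha> x)) \<le> ennreal (2 powr (2 * \<kappa>)) * ?g x" for x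
  proof (cases "x \<in> Bplus")
    case True
    then show ?thesis using A2k_omega_plus_le[OF assms(1,2) True] Bplus_norm[OF True]
      by (auto simp flip: ennreal_mult intro!: ennreal_leI)
  qed (simp add: omega_plus_def A2k_def)
  then have "(\<integral>\<^sup>+x. ennreal (A2k \<kappa> (omega_plus \<alpha> x)) \<partial>lborel) \<le>
      (\<integral>\<^sup>+x. ennreal (2 powr (2 * \<kappa>)) * ?g x \<partial>lborel)"
    by (intro nn_integral_mono) auto
  also have "\<dots> = ennreal (2 powr (2 * \<kappa>)) * (\<integral>\<^sup>+x. ?g x \<partial>lborel)"
    by (rule nn_integral_cmult) measurable
  also have "\<dots> < \<infinity>"
    using nn_integral_inverse_log_finite[of "2 * (\<alpha> - \<kappa>)"] assms
    by (simp add: ennreal_mult_less_top)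
  finally show ?thesis .
qed

lemma omega_plus_integrable:
  assumes "\<alpha> \<ge> 0"
  shows "integrable lborel (omega_plus \<alpha>)"
proof (rule integrableI_nonneg)
  have "(\<integral>\<^sup>+x. ennreal (omega_plus \<alpha> x) \<partial>lborel) \<le>
    (\<integral>\<^sup>+x. ennreal (1 / norm (x - (0 :: real \<times> real))) * indicator (cball 0 (1/3)) x \<partial>lborel)"
  proof (rule nn_integral_mono)
    fix x :: "real \<times> real"
    show "ennreal (omega_plus \<alpha> x) \<le> ennreal (1 / norm (x - 0)) * indicator (cball 0 (1/3)) x"
    proof (cases "x \<in> Bplus")
      case True
      then show ?thesis using omega_plus_le_inverse_norm[OF assms, of x] Bplus_norm[OF True]
        by (auto intro!: ennreal_leI)
    qed (simp add: omega_plus_def)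
  qed
  also have "\<dots> < \<infinity>" by (subst nn_integral_inverse_norm_cball) auto
  finally show "(\<integral>\<^sup>+x. ennreal (omega_plus \<alpha> x) \<partial>lborel) < \<infinity>" .
qed (auto simp: omega_plus_nonneg)

lemma omega_n_integrable:
  assumes "\<alpha> \<ge> 0" "n \<ge> 2"
  shows "integrable lborel (omega_n \<alpha> n)"
proof -
  obtain M where M: "M \<ge> 0" "\<And>x. omega_n \<alpha> n x \<le> M * indicator (cball 0 (1/2)) x"
    using omega_n_bounded[OF assms] by blast
  have "integrable lborel (\<lambda>x :: real \<times> real. M * indicator (cball 0 (1/2)) x)"
    by (intro integrable_mult_right integrable_real_indicator emeasure_bounded_finite) auto
  then show ?thesis
  proof (rule Bochner_Integration.integrable_bound)
    have "norm (omega_n \<alpha> n x) \<le> norm (M * indicator (cball 0 (1/2)) x)" for x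
      using M(2)[of x] omega_n_nonneg[of \<alpha> n x] by simp
    then show "AE x in lborel. norm (omega_n \<alpha> n x) \<le> norm (M * indicator (cball 0 (1/2)) x)" by simp
  qed simp
qed

lemma integrable_imp_in_L2logL:
  assumes "integrable lborel f" "orlicz_modular \<kappa> f < \<infinity>"
  shows "in_L2logL \<kappa> f"
proof -
  have "set_integrable lborel K f" if "compact K" for K
  proof -
    have "K \<in> sets borel" using that by (intro borel_closed compact_imp_closed)
    then show ?thesis unfolding set_integrable_def using assms(1) by (intro integrable_mult_indicator) simp_all
  qed
  then show ?thesis using assms unfolding in_L2logL_def by (blast dest: borel_measurable_integrable)
qed

lemma in_L2logL_omega_plus:
  assumes "\<kappa> \<ge> 0" "\<alpha> \<ge> 0" "\<kappa> < \<alpha> - 1/2"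
  shows "in_L2logL \<kappa> (omega_plus \<alpha>)"
  using orlicz_modular_omega_plus_finite[OF assms] omega_plus_integrable[OF assms(2)]
  by (intro integrable_imp_in_L2logL) (simp_all add: orlicz_modular_def omega_plus_nonneg)

lemma in_L2logL_omega_n:
  assumes "\<kappa> \<ge> 0" "\<alpha> \<ge> 0" "n \<ge> 2"
  shows "in_L2logL \<kappa> (omega_n \<alpha> n)"
proof -
  obtain M where M: "M \<ge> 0" "\<And>x. omega_n \<alpha> n x \<le> M * indicator (cball 0 (1/2)) x"
    using omega_n_bounded[OF assms(2,3)] by blast
  have "(\<integral>\<^sup>+x. ennreal (A2k \<kappa> \<bar>omega_n \<alpha> n x\<bar>) \<partial>lborel) \<le>
      (\<integral>\<^sup>+x. ennreal (A2k \<kappa> M) * indicator (cball (0 :: real \<times> real) (1/2)) x \<partial>lborel)"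
  proof (rule nn_integral_mono)
    fix x :: "real \<times> real"
    show "ennreal (A2k \<kappa> \<bar>omega_n \<alpha> n x\<bar>) \<le> ennreal (A2k \<kappa> M) * indicator (cball 0 (1/2)) x"
    proof (cases "x \<in> cball 0 (1/2)")
      case True
      then show ?thesis using M(2)[of x] omega_n_nonneg[of \<alpha> n x] assms
        by (auto intro!: ennreal_leI A2k_mono)
    next
      case False
      then show ?thesis using M(2)[of x] omega_n_nonneg[of \<alpha> n x] by (simp add: A2k_def)
    qed
  qed
  also have "\<dots> = ennreal (A2k \<kappa> M) * emeasure lborel (cball (0 :: real \<times> real) (1/2))"
    by (subst nn_integral_cmult_indicator) auto
  also have "\<dots> < \<infinity>"
    using emeasure_bounded_finite[of "cball (0 :: real \<times> real) (1/2)"] by (simp add: ennreal_mult_less_top)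
  finally show ?thesis
    using omega_n_integrable[OF assms(2,3)]
    by (intro integrable_imp_in_L2logL) (simp_all add: orlicz_modular_def)
qed

section \<open>Strong convergence in the Orlicz space\<close>

text \<open>The majorant is the Young function of \<open>omega_plus\<close> divided by
  \<open>e\<close>, whose integral is finite by \<open>A2k_scale\<close>. Off the horizontal axis
  the difference is zero as soon as 1/n < |x|. The shift by 4 makes the domination valid for every
  index.\<close>

lemma orlicz_modular_omega_diff_tendsto:
  assumes "\<kappa> \<ge> 0" "\<alpha> \<ge> 0" "\<alpha> \<le> 1" "\<kappa> < \<alpha> - 1/2" "0 < e" "e \<le> 1"
  shows "(\<lambda>n. orlicz_modular \<kappa> (\<lambda>x. (omega_n \<alpha> n x - omega_plus \<alpha> x) / e)) \<longlonglongrightarrow> 0"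
proof (rule LIMSEQ_offset[where k=4])
  let ?u = "\<lambda>n x. ennreal (A2k \<kappa> \<bar>(omega_n \<alpha> (n + 4) x - omega_plus \<alpha> x) / e\<bar>)"
  let ?w = "\<lambda>x. ennreal (A2k \<kappa> (omega_plus \<alpha> x / e))"
  have "(\<lambda>n. \<integral>\<^sup>+x. ?u n x \<partial>lborel) \<longlonglongrightarrow> (\<integral>\<^sup>+x. 0 \<partial>(lborel :: (real \<times> real) measure))"
  proof (rule nn_integral_dominated_convergence[where w="?w"])
    show "AE x in lborel. ?u j x \<le> ?w x" for j
      using AE_lborel_snd_nonzero
    proof eventually_elim
      case (elim x)
      then have "omega_n \<alpha> (j + 4) x \<le> omega_plus \<alpha> x"
        using assms by (intro omega_n_le_omega_plus) auto
      then have "\<bar>(omega_n \<alpha> (j + 4) x - omega_plus \<alpha> x) / e\<bar> \<le> omega_plus \<alpha> x / e"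
        unfolding abs_divide
        using omega_n_nonneg[of \<alpha> "j + 4" x] assms by (intro frac_le) auto
      then show ?case using assms by (intro ennreal_leI A2k_mono) auto
    qed
    let ?C = "(1 / e * (1 + ln (1 / e) / ln 2) powr \<kappa>)\<^sup>2"
    have "(\<integral>\<^sup>+x. ?w x \<partial>lborel) \<le> (\<integral>\<^sup>+x. ennreal ?C * ennreal (A2k \<kappa> (omega_plus \<alpha> x)) \<partial>lborel)"
    proof (rule nn_integral_mono)
      fix x
      have "?w x \<le> ennreal (?C * A2k \<kappa> (omega_plus \<alpha> x))"
        using assms by (intro ennreal_leI A2k_scale omega_plus_nonneg) auto
      also have "\<dots> = ennreal ?C * ennreal (A2k \<kappa> (omega_plus \<alpha> x))"
        by (rule ennreal_mult) (simp_all add: A2k_def)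
      finally show "?w x \<le> ennreal ?C * ennreal (A2k \<kappa> (omega_plus \<alpha> x))" .
    qed
    also have "\<dots> = ennreal ?C * (\<integral>\<^sup>+x. ennreal (A2k \<kappa> (omega_plus \<alpha> x)) \<partial>lborel)"
      by (rule nn_integral_cmult) measurable
    also have "\<dots> < \<infinity>"
      using orlicz_modular_omega_plus_finite[of \<kappa> \<alpha>] assms by (simp add: ennreal_mult_less_top)
    finally show "(\<integral>\<^sup>+x. ?w x \<partial>lborel) < \<infinity>" .
    show "AE x in lborel. (\<lambda>n. ?u n x) \<longlonglongrightarrow> 0"
      using AE_lborel_snd_nonzero
    proof eventually_elim
      case (elim x)
      then have "norm x > 0" by auto
      then obtain N where N: "inverse (real (Suc N)) < norm x"
        using reals_Archimedean by blast
      have "?u n x = 0" if "n \<ge> N" for n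
      proof -
        have "1 / real (n + 4) \<le> inverse (real (Suc N))" using that by (simp add: field_simps)
        then have "norm x > 1 / real (n + 4)" using N by simp
        then have "omega_n \<alpha> (n + 4) x = omega_plus \<alpha> x"
          by (auto simp: omega_n_def omega_plus_def Bplus_def)
        then show ?thesis by (simp add: A2k_def)
      qed
      then show ?case
        by (intro tendsto_eventually eventually_sequentiallyI[of N]) auto
    qed
  qed measurable
  then show "(\<lambda>n. orlicz_modular \<kappa> (\<lambda>x. (omega_n \<alpha> (n + 4) x - omega_plus \<alpha> x) / e)) \<longlonglongrightarrow> 0"
    by (simp add: orlicz_modular_def)
qed

text \<open>For each fixed d the modular of the difference divided by d is eventually below 1, so d
  belongs to the set whose infimum is the norm.\<close>

lemma lux_norm_omega_diff_tendsto:
  assumes "\<kappa> \<ge> 0" "\<alpha> \<ge> 0" "\<alpha> \<le> 1" "\<kappa> < \<alpha> - 1/2"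
  shows "(\<lambda>n. lux_norm \<kappa> (\<lambda>x. omega_n \<alpha> n x - omega_plus \<alpha> x)) \<longlonglongrightarrow> 0"
proof (rule LIMSEQ_I)
  fix e :: real assume "e > 0"
  \<comment> \<open>Strictly below \<open>e\<close>, and at most 1 as the modular limit
    requires.\<close>
  define d where "d = min (e / 2) 1"
  have d: "0 < d" "d \<le> 1" "d < e" using \<open>e > 0\<close> by (auto simp: d_def)
  have "eventually (\<lambda>n. orlicz_modular \<kappa> (\<lambda>x. (omega_n \<alpha> n x - omega_plus \<alpha> x) / d) < 1) sequentially"
    using orlicz_modular_omega_diff_tendsto[OF assms d(1,2)] by (rule order_tendstoD) simp
  then obtain N where N: "\<And>n. n \<ge> N \<Longrightarrow> orlicz_modular \<kappa> (\<lambda>x. (omega_n \<alpha> n x - omega_plus \<alpha> x) / d) < 1"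
    by (auto simp: eventually_sequentially)
  have "norm (lux_norm \<kappa> (\<lambda>x. omega_n \<alpha> n x - omega_plus \<alpha> x) - 0) < e" if "n \<ge> N" for n
  proof -
    let ?S = "{k::real. k > 0 \<and> orlicz_modular \<kappa> (\<lambda>x. (omega_n \<alpha> n x - omega_plus \<alpha> x) / k) \<le> 1}"
    have "d \<in> ?S" using N[OF that] d by auto
    moreover have "bdd_below ?S" by (auto intro!: bdd_belowI[of _ 0])
    ultimately have "Inf ?S \<le> d" by (rule cInf_lower)
    \<comment> \<open>A real infimum is bounded below by a lower bound only if the set is nonempty;
      \<open>d\<close> is the witness.\<close>
    moreover have "0 \<le> Inf ?S"
    proof (rule cInf_greatest)
      show "?S \<noteq> {}" using \<open>d \<in> ?S\<close> by blast
      show "0 \<le> k" if "k \<in> ?S" for k using that by simp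
    qed
    ultimately have "Inf ?S \<le> d" "0 \<le> Inf ?S" by blast+
    then show ?thesis using d unfolding lux_norm_def by simp
  qed
  then show "\<exists>N. \<forall>n\<ge>N. norm (lux_norm \<kappa> (\<lambda>x. omega_n \<alpha> n x - omega_plus \<alpha> x) - 0) < e" by blast
qed

section \<open>The velocity\<close>

lemma has_bochner_integral_inverse_norm_cball:
  fixes a :: "real \<times> real"
  assumes "R \<ge> 0"
  shows "has_bochner_integral lborel (\<lambda>y. 1 / norm (y - a) * indicator (cball a R) y) (2 * unit_disk_area * R)"
proof (rule has_bochner_integral_nn_integral)
  have "(\<integral>\<^sup>+y. ennreal (1 / norm (y - a) * indicator (cball a R) y) \<partial>lborel)
    = (\<integral>\<^sup>+y. ennreal (1 / norm (y - a)) * indicator (cball a R) y \<partial>lborel)"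
    by (intro nn_integral_cong) (simp split: split_indicator)
  then show "(\<integral>\<^sup>+y. ennreal (1 / norm (y - a) * indicator (cball a R) y) \<partial>lborel)
      = ennreal (2 * unit_disk_area * R)"
    using nn_integral_inverse_norm_cball[OF assms] by simp
  show "(\<lambda>y. 1 / norm (y - a) * indicator (cball a R) y) \<in> borel_measurable lborel"
  proof -
    have [measurable]: "cball a R \<in> sets borel" by simp
    show ?thesis by measurable
  qed
qed (use assms unit_disk_area_nonneg in auto)

lemma has_bochner_integral_inverse_norm_cube:
  assumes "R > 0"
  shows "has_bochner_integral lborel (\<lambda>y :: real \<times> real. 1 / norm y ^ 3 * indicator {R..} (norm y))
    (2 * unit_disk_area / R)"
proof (rule has_bochner_integral_nn_integral)
  have "(\<integral>\<^sup>+y. ennreal (1 / norm (y :: real \<times> real) ^ 3 * indicator {R..} (norm y)) \<partial>lborel)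
    = (\<integral>\<^sup>+y. ennreal (1 / norm (y :: real \<times> real) ^ 3) * indicator {R..} (norm y) \<partial>lborel)"
    by (intro nn_integral_cong) (simp split: split_indicator)
  then show "(\<integral>\<^sup>+y. ennreal (1 / norm (y :: real \<times> real) ^ 3 * indicator {R..} (norm y)) \<partial>lborel)
      = ennreal (2 * unit_disk_area / R)"
    using nn_integral_inverse_norm_cube[OF assms] by simp
qed (use assms unit_disk_area_nonneg in auto)

section \<open>Pointwise estimates of the kernel\<close>

text \<open>The distance formula for the inversion a / |a|^2 in the unit sphere, obtained by
  expanding the squared norm. The Biot-Savart kernel is this inversion rotated and scaled, so the
  formula measures how the kernel changes under translation.\<close>

lemma norm_inversion_diff:
  fixes a b :: "'a::real_inner"
  assumes "a \<noteq> 0" "b \<noteq> 0"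
  shows "norm ((1 / (norm a)\<^sup>2) *\<^sub>R a - (1 / (norm b)\<^sup>2) *\<^sub>R b) = norm (a - b) / (norm a * norm b)"
proof -
  define A where "A = norm a"
  define B where "B = norm b"
  have AB: "A > 0" "B > 0" "a \<bullet> a = A\<^sup>2" "b \<bullet> b = B\<^sup>2"
    using assms by (auto simp: A_def B_def power2_norm_eq_inner)
  have "(norm ((1 / A\<^sup>2) *\<^sub>R a - (1 / B\<^sup>2) *\<^sub>R b))\<^sup>2 =
      (a \<bullet> a) / (A\<^sup>2 * A\<^sup>2) - 2 * (a \<bullet> b) / (A\<^sup>2 * B\<^sup>2) + (b \<bullet> b) / (B\<^sup>2 * B\<^sup>2)"
    unfolding power2_norm_eq_inner
    by (simp add: inner_diff_left inner_diff_right inner_commute[of b a] diff_divide_distrib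
        power2_eq_square power4_eq_xxxx mult_ac)
  also have "\<dots> = (A\<^sup>2 - 2 * (a \<bullet> b) + B\<^sup>2) / (A\<^sup>2 * B\<^sup>2)"
    using AB by (simp add: field_simps power2_eq_square)
  also have "A\<^sup>2 - 2 * (a \<bullet> b) + B\<^sup>2 = (norm (a - b))\<^sup>2"
    using AB by (simp add: power2_norm_eq_inner inner_diff_left inner_diff_right inner_commute[of b a])
  also have "(norm (a - b))\<^sup>2 / (A\<^sup>2 * B\<^sup>2) = (norm (a - b) / (A * B))\<^sup>2"
    by (simp add: power_divide power_mult_distrib)
  finally have "norm ((1 / A\<^sup>2) *\<^sub>R a - (1 / B\<^sup>2) *\<^sub>R b) = norm (a - b) / (A * B)"
    by (rule power2_eq_imp_eq) (use AB in auto)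
  then show ?thesis by (simp add: A_def B_def)
qed

lemma abs_snd_le_norm: "\<bar>snd z\<bar> \<le> norm (z :: real \<times> real)"
  using norm_snd_le[of "snd z" "fst z"] by simp

text \<open>The integrand is at most 1/(AB) in absolute value, with A = |y - x| and B = |y|. Partial
  fractions and |x| \<le> A + B split this product of two singularities into a sum of two integrable
  ones.\<close>

lemma kernel_near_lower_bound:
  fixes x y :: "real \<times> real"
  assumes "x \<noteq> 0" "y \<noteq> 0" "0 \<le> w" "w \<le> 1 / norm y"
  shows "w * (snd (y - x) / (norm (y - x))\<^sup>2) \<ge> - (1 / norm x * (1 / norm y + 1 / norm (y - x)))"
proof (cases "y = x")
  case True
  then show ?thesis by simp
next
  case False
  define A where "A = norm (y - x)"
  define B where "B = norm y"
  define r where "r = norm x"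
  have pos: "A > 0" "B > 0" "r > 0" using assms False by (auto simp: A_def B_def r_def)
  have r: "r \<le> A + B" using norm_triangle_ineq4[of y "y - x"] by (simp add: A_def B_def r_def)
  have "- snd (y - x) / A\<^sup>2 \<le> A / A\<^sup>2"
    using abs_snd_le_norm[of "y - x"] by (intro divide_right_mono) (auto simp: A_def)
  also have "A / A\<^sup>2 = 1 / A" using pos by (simp add: power2_eq_square)
  finally have "w * (- snd (y - x) / A\<^sup>2) \<le> w * (1 / A)"
    using assms(3) by (rule mult_left_mono)
  also have "\<dots> \<le> (1 / B) * (1 / A)"
    using assms(4) pos by (intro mult_right_mono) (simp_all add: B_def)
  also have "(1 / B) * (1 / A) = (1 / B + 1 / A) / (A + B)"
  proof -
    have "1 / B + 1 / A = (1 / B) * (1 / A) * (A + B)" using pos by (simp add: field_simps)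
    moreover have "A + B \<noteq> 0" using pos by simp
    ultimately show ?thesis by simp
  qed
  also have "\<dots> \<le> (1 / B + 1 / A) / r"
    using pos r by (intro frac_le) simp_all
  finally have "- (w * (snd (y - x) / A\<^sup>2)) \<le> 1 / r * (1 / B + 1 / A)" by (simp del: snd_diff)
  then show ?thesis unfolding A_def B_def r_def by linarith
qed

text \<open>By the inversion formula the two kernels differ by at most |x| / (|y - x| |y|), and |y -
  x| \<ge> |y| / 2 in this range.\<close>

lemma kernel_far_lower_bound:
  fixes x y :: "real \<times> real"
  assumes "x \<noteq> 0" "norm y \<ge> 2 * norm x"
  shows "snd (y - x) / (norm (y - x))\<^sup>2 \<ge> snd y / (norm y)\<^sup>2 - 2 * norm x / (norm y)\<^sup>2"
proof -
  define A where "A = norm (y - x)"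
  define B where "B = norm y"
  have "norm x > 0" using assms(1) by simp
  then have B: "B > 0" using assms(2) unfolding B_def by linarith
  have A: "A \<ge> B / 2" using norm_triangle_sub[of y x] assms by (simp add: A_def B_def norm_minus_commute)
  have "A > 0" using A B by linarith
  then have nz: "y - x \<noteq> 0" "y \<noteq> 0" using B by (auto simp: A_def B_def)
  let ?v = "(1 / A\<^sup>2) *\<^sub>R (y - x) - (1 / B\<^sup>2) *\<^sub>R y"
  have "\<bar>snd ?v\<bar> \<le> norm ?v" by (rule abs_snd_le_norm)
  also have "norm ?v = norm x / (A * B)"
    using norm_inversion_diff[OF nz] by (simp add: A_def B_def)
  also have "\<dots> \<le> norm x / ((B / 2) * B)"
    using A B \<open>A > 0\<close> by (intro frac_le mult_right_mono) simp_all
  also have "\<dots> = 2 * norm x / B\<^sup>2" using B by (simp add: power2_eq_square)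
  finally have "\<bar>snd (y - x) / A\<^sup>2 - snd y / B\<^sup>2\<bar> \<le> 2 * norm x / B\<^sup>2" by simp
  then show ?thesis unfolding A_def B_def by linarith
qed

lemma norm_BS_kernel: "norm (BS_kernel z) = 1 / (2 * pi * norm z)"
proof -
  have "norm (perp z) = norm z" by (simp add: perp_def norm_prod_def add.commute)
  then show ?thesis by (simp add: BS_kernel_def power2_eq_square)
qed

text \<open>The minus sign in \<open>perp\<close> reverses the difference: nonnegative vorticity
  above \<open>x\<close> contributes nonnegatively to the first velocity component.\<close>

lemma fst_BS_kernel: "2 * pi * fst (BS_kernel (x - y)) = snd (y - x) / (norm (y - x))\<^sup>2"
  by (simp add: BS_kernel_def perp_def norm_minus_commute)

lemma BS_kernel_measurable[measurable]: "BS_kernel \<in> borel_measurable borel"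
proof -
  have [measurable]: "perp \<in> borel_measurable borel"
    unfolding perp_def[abs_def] by (intro borel_measurable_continuous_onI continuous_intros)
  show ?thesis unfolding BS_kernel_def[abs_def] by measurable
qed

lemma BS_conv_measurable[measurable]:
  assumes [measurable]: "w \<in> borel_measurable borel"
  shows "BS_conv w \<in> borel_measurable borel"
  unfolding BS_conv_def[abs_def] by measurable

section \<open>Velocity of a bounded nonnegative vorticity supported in a disk\<close>

context
  fixes w :: "real \<times> real \<Rightarrow> real" and M :: real
  assumes w_measurable[measurable]: "w \<in> borel_measurable borel"
    and w_nonneg: "\<And>y. 0 \<le> w y"
    and w_le: "\<And>y. w y \<le> M * indicator (cball 0 (1/2)) y"
begin

text \<open>The ball of radius 1/2 + |x| about \<open>x\<close> contains the support of
  \<open>w\<close>, so the majorant is a truncated 1/|y - x| with known integral.\<close>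

lemma norm_BS_integrand_le:
  "norm (w y *\<^sub>R BS_kernel (x - y)) \<le>
     M / (2 * pi) * (1 / norm (y - x) * indicator (cball x (1/2 + norm x)) y)"
proof (cases "y \<in> cball 0 (1/2)")
  case True
  have "dist x y \<le> 1/2 + norm x" using True norm_triangle_ineq4[of x y] by (simp add: dist_norm)
  moreover have "w y * (1 / (2 * pi * norm (y - x))) \<le> M * (1 / (2 * pi * norm (y - x)))"
    using w_le[of y] True by (intro mult_right_mono) auto
  ultimately show ?thesis using w_nonneg[of y]
    by (simp add: norm_BS_kernel norm_minus_commute)
next
  case False
  then have "w y = 0" using w_le[of y] w_nonneg[of y] by simp
  moreover have "M \<ge> 0" using w_le[of 0] w_nonneg[of 0] by simp
  ultimately show ?thesis by simp
qed

lemma BS_integrable: "integrable lborel (\<lambda>y. w y *\<^sub>R BS_kernel (x - y))"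
proof (rule Bochner_Integration.integrable_bound)
  show "integrable lborel (\<lambda>y. M / (2 * pi) * (1 / norm (y - x) * indicator (cball x (1/2 + norm x)) y))"
    using has_bochner_integral_inverse_norm_cball[of "1/2 + norm x" x]
    by (intro integrable_mult_right) (auto simp: has_bochner_integral_iff)
  have "norm (w y *\<^sub>R BS_kernel (x - y)) \<le>
     norm (M / (2 * pi) * (1 / norm (y - x) * indicator (cball x (1/2 + norm x)) y))" for y
    by (rule order_trans[OF norm_BS_integrand_le]) (simp only: real_norm_def abs_ge_self)
  then show "AE y in lborel. norm (w y *\<^sub>R BS_kernel (x - y)) \<le>
     norm (M / (2 * pi) * (1 / norm (y - x) * indicator (cball x (1/2 + norm x)) y))" by simp
qed measurable

text \<open>A crude bound depending on \<open>M\<close>; it serves to make velocity times squared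
  vorticity integrable.\<close>

lemma norm_BS_conv_le: "norm (BS_conv w x) \<le> M / (2 * pi) * (2 * unit_disk_area * (1/2 + norm x))"
proof -
  note hb = has_bochner_integral_inverse_norm_cball[of "1/2 + norm x" x]
  have "norm (BS_conv w x) \<le> (\<integral>y. norm (w y *\<^sub>R BS_kernel (x - y)) \<partial>lborel)"
    unfolding BS_conv_def by (rule integral_norm_bound)
  also have "\<dots> \<le> (\<integral>y. M / (2 * pi) * (1 / norm (y - x) * indicator (cball x (1/2 + norm x)) y) \<partial>lborel)"
    using hb by (intro integral_mono integrable_mult_right integrable_norm BS_integrable norm_BS_integrand_le)
      (auto simp: has_bochner_integral_iff)
  also have "\<dots> = M / (2 * pi) * (2 * unit_disk_area * (1/2 + norm x))"
    using hb by (subst integral_mult_right_zero) (auto simp: has_bochner_integral_iff)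
  finally show ?thesis .
qed

text \<open>\<open>g\<close> is any nonnegative minorant of the far part of the integrand with the
  kernel recentred at the origin. All remaining terms are controlled by
  \<open>w y \<le> 1 / norm y\<close>, and by scaling their total does not depend on
  \<open>x\<close> or \<open>M\<close>.\<close>

lemma fst_BS_conv_lower_bound:
  assumes x: "x \<noteq> 0"
    and w_inv: "\<And>y. y \<noteq> 0 \<Longrightarrow> w y \<le> 1 / norm y"
    and [measurable]: "g \<in> borel_measurable borel" and g_nonneg: "\<And>y. 0 \<le> g y"
    and g_near: "\<And>y. norm y < 2 * norm x \<Longrightarrow> g y = 0"
    and g_far: "\<And>y. norm y \<ge> 2 * norm x \<Longrightarrow> g y \<le> w y * (snd y / (norm y)\<^sup>2)"
    and G: "(\<integral>\<^sup>+y. ennreal (g y) \<partial>lborel) = ennreal G" "G \<ge> 0"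
  shows "2 * pi * fst (BS_conv w x) \<ge> G - 12 * unit_disk_area"
proof -
  define r where "r = norm x"
  have r: "r > 0" using x by (simp add: r_def)
  \<comment> \<open>The first two terms cover the near region |y| < 2r, which lies in the ball of
    radius 3r about \<open>x\<close>; the last is the far kernel error 2r/|y|^2 times 1/|y|. In
    units of \<open>unit_disk_area\<close> they integrate to 4, 6 and 2.\<close>
  define e where "e = (\<lambda>y. 1 / r * (1 / norm (y - 0) * indicator (cball 0 (2 * r)) y
      + 1 / norm (y - x) * indicator (cball x (3 * r)) y)
      + 2 * r * (1 / norm y ^ 3 * indicator {2 * r..} (norm y)))"
  have "has_bochner_integral lborel e (1 / r * (2 * unit_disk_area * (2 * r) + 2 * unit_disk_area * (3 * r))
      + 2 * r * (2 * unit_disk_area / (2 * r)))"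
    unfolding e_def using r
    by (intro has_bochner_integral_add has_bochner_integral_mult_right
        has_bochner_integral_inverse_norm_cball has_bochner_integral_inverse_norm_cube) auto
  also have "1 / r * (2 * unit_disk_area * (2 * r) + 2 * unit_disk_area * (3 * r))
      + 2 * r * (2 * unit_disk_area / (2 * r)) = 12 * unit_disk_area"
    using r by (simp add: field_simps)
  finally have e: "integrable lborel e" "(\<integral>y. e y \<partial>lborel) = 12 * unit_disk_area"
    by (auto simp: has_bochner_integral_iff)
  have g: "has_bochner_integral lborel g G"
    by (rule has_bochner_integral_nn_integral) (use G g_nonneg in auto)
  define f where "f = (\<lambda>y. 2 * pi * fst (w y *\<^sub>R BS_kernel (x - y)))"
  have f: "integrable lborel f" "(\<integral>y. f y \<partial>lborel) = 2 * pi * fst (BS_conv w x)"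
  proof -
    have "integrable lborel (\<lambda>y. fst (w y *\<^sub>R BS_kernel (x - y)))"
      by (rule integrable_bounded_linear[OF bounded_linear_fst BS_integrable])
    moreover have "(\<integral>y. fst (w y *\<^sub>R BS_kernel (x - y)) \<partial>lborel) = fst (BS_conv w x)"
      unfolding BS_conv_def by (rule integral_bounded_linear[OF bounded_linear_fst BS_integrable])
    ultimately show "integrable lborel f" "(\<integral>y. f y \<partial>lborel) = 2 * pi * fst (BS_conv w x)"
      unfolding f_def by auto
  qed
  have "g y - e y \<le> f y" if y: "y \<noteq> 0" for y
  proof -
    have f_eq: "f y = w y * (snd (y - x) / (norm (y - x))\<^sup>2)"
      unfolding f_def using fst_BS_kernel[of x y] by (simp add: mult.left_commute)
    show ?thesis
    proof (cases "norm y < 2 * r")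
      case True
      then have "dist x y \<le> 3 * r" using norm_triangle_ineq4[of x y] by (simp add: r_def dist_norm)
      then have "e y = 1 / r * (1 / norm y + 1 / norm (y - x))"
        using True by (simp add: e_def)
      moreover have "g y = 0" using g_near True by (simp add: r_def)
      moreover have "f y \<ge> - (1 / r * (1 / norm y + 1 / norm (y - x)))"
        unfolding f_eq r_def using x y w_nonneg w_inv by (intro kernel_near_lower_bound) auto
      ultimately show ?thesis by simp
    next
      case False
      then have far: "norm y \<ge> 2 * norm x" by (simp add: r_def)
      have "w y * (snd y / (norm y)\<^sup>2 - 2 * r / (norm y)\<^sup>2) \<le> f y"
        unfolding f_eq r_def using kernel_far_lower_bound[OF x far] w_nonneg[of y]
        by (intro mult_left_mono)
      moreover have "w y * (2 * r / (norm y)\<^sup>2) \<le> 1 / norm y * (2 * r / (norm y)\<^sup>2)"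
        using w_inv[OF y] r by (intro mult_right_mono) auto
      moreover have "1 / norm y * (2 * r / (norm y)\<^sup>2) \<le> e y"
      proof -
        have "e y \<ge> 2 * r * (1 / norm y ^ 3 * indicator {2 * r..} (norm y))"
          unfolding e_def using r by simp
        then show ?thesis using False by (simp add: power2_eq_square power3_eq_cube)
      qed
      moreover have "g y \<le> w y * (snd y / (norm y)\<^sup>2)" by (rule g_far[OF far])
      ultimately show ?thesis by (simp add: right_diff_distrib)
    qed
  qed
  \<comment> \<open>The origin is left out: the bound by 1/|y| is not assumed there, where division
    by zero would make it 0.\<close>
  then have "AE y in lborel. g y - e y \<le> f y"
    using AE_lborel_singleton[of "0 :: real \<times> real"] by (auto elim!: eventually_mono)
  then have "(\<integral>y. g y - e y \<partial>lborel) \<le> (\<integral>y. f y \<partial>lborel)"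
    using g e f by (intro integral_mono_AE Bochner_Integration.integrable_diff) (auto simp: has_bochner_integral_iff)
  also have "(\<integral>y. g y - e y \<partial>lborel) = G - 12 * unit_disk_area"
    using g e by (subst Bochner_Integration.integral_diff) (auto simp: has_bochner_integral_iff)
  finally show ?thesis using f by simp
qed

end

section \<open>Lower bounds for the velocity of the truncated vorticities\<close>

lemma omega_n_mult_snd_nonneg: "0 \<le> omega_n \<alpha> n y * (snd y / (norm y)\<^sup>2)"
  using omega_n_nonneg[of \<alpha> n y] by (cases "snd y < 0") (simp_all add: omega_n_def)

text \<open>Taking the minorant 0 gives a bound uniform in \<open>n\<close> and \<open>x\<close>,
  since the vorticity vanishes in the lower half-plane.\<close>

lemma fst_BS_conv_omega_n_ge:
  assumes "\<alpha> \<ge> 0" "n \<ge> 3" "x \<noteq> 0"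
  shows "2 * pi * fst (BS_conv (omega_n \<alpha> n) x) \<ge> - 12 * unit_disk_area"
proof -
  have "n \<ge> 2" using assms by simp
  from omega_n_bounded[OF assms(1) this]
  obtain M where M: "\<And>x. omega_n \<alpha> n x \<le> M * indicator (cball 0 (1/2)) x" by blast
  have "2 * pi * fst (BS_conv (omega_n \<alpha> n) x) \<ge> 0 - 12 * unit_disk_area"
  proof (rule fst_BS_conv_lower_bound[OF omega_n_measurable omega_n_nonneg M assms(3), where g = "\<lambda>_. 0"])
    show "omega_n \<alpha> n y \<le> 1 / norm y" if "y \<noteq> 0" for y
      using that assms by (intro omega_n_le_inverse_norm)
    show "0 \<le> omega_n \<alpha> n y * (snd y / (norm y)\<^sup>2)" for y
      by (rule omega_n_mult_snd_nonneg)
  qed simp_all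
  then show ?thesis by simp
qed

text \<open>The minorant keeps only the sector between radii 2|x| and 1/4, where the vorticity is
  untruncated because 1/n < |x|. With l = |ln |x||, the logarithm there is at most l, so the
  integrand is at least l^(-\<alpha>) / (2 |y|^2), and the logarithmic width of the shell is at
  least l/2.\<close>

lemma fst_BS_conv_omega_n_sector_ge:
  assumes \<alpha>: "0 \<le> \<alpha>" "\<alpha> \<le> 1" and n: "n \<ge> 3" and x: "1 / real n < norm x" "norm x \<le> 1/64"
  shows "2 * pi * fst (BS_conv (omega_n \<alpha> n) x) \<ge>
    upper_sector_area / 2 * \<bar>ln (norm x)\<bar> powr (1 - \<alpha>) - 12 * unit_disk_area"
proof -
  define r where "r = norm x"
  define l where "l = \<bar>ln r\<bar>"
  have r: "0 < r" "r \<le> 1/64" using x le_less_trans[of 0 "1 / real n" "norm x"] by (auto simp: r_def)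
  have l: "l \<ge> 1" "ln r = - l" using abs_ln_ge_1[of r] r by (auto simp: l_def)
  \<comment> \<open>The radius 1/64 is 8^(-2): the shell has logarithmic width l - ln 8, and ln 8
    must not exceed l/2.\<close>
  have "ln r \<le> ln (1/64)" using r by (subst ln_le_cancel_iff) auto
  also have "\<dots> = - 2 * ln 8" using ln_realpow[of 8 2] by (simp add: ln_div)
  finally have l8: "2 * ln 8 \<le> l" using l by simp
  \<comment> \<open>One factor 1/2 from the sector condition, and the logarithm of the vorticity
    frozen at its upper bound.\<close>
  define c where "c = 1 / (2 * l powr \<alpha>)"
  have c: "c > 0" using l by (simp add: c_def)
  define g where "g = (\<lambda>y :: real \<times> real. c * (1 / norm y ^ 2 * indicator {2 * r..1/4} (norm y) * indicator upper_sector y))"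
  define G where "G = c * (2 * upper_sector_area * (ln (1/4) - ln (2 * r)))"
  have "n \<ge> 2" using n by simp
  from omega_n_bounded[OF \<alpha>(1) this]
  obtain M where M: "\<And>x. omega_n \<alpha> n x \<le> M * indicator (cball 0 (1/2)) x" by blast
  have "2 * pi * fst (BS_conv (omega_n \<alpha> n) x) \<ge> G - 12 * unit_disk_area"
  proof (rule fst_BS_conv_lower_bound[OF omega_n_measurable omega_n_nonneg M])
    show "x \<noteq> 0" using r by (auto simp: r_def)
    show "omega_n \<alpha> n y \<le> 1 / norm y" if "y \<noteq> 0" for y
      using that assms by (intro omega_n_le_inverse_norm) auto
    show "g \<in> borel_measurable borel" unfolding g_def by measurable
    show "0 \<le> g y" for y unfolding g_def using c by simp
    show "g y = 0" if "norm y < 2 * norm x" for y using that by (simp add: g_def r_def)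
    show "g y \<le> omega_n \<alpha> n y * (snd y / (norm y)\<^sup>2)" if "norm y \<ge> 2 * norm x" for y
    proof (cases "norm y \<le> 1/4 \<and> y \<in> upper_sector")
      case True
      define s where "s = norm y"
      have s: "2 * r \<le> s" "s \<le> 1/4" "s \<le> 2 * snd y"
        using True that by (auto simp: s_def r_def upper_sector_def)
      have s0: "s > 0" "s > 1 / real n" using s(1) r(1) x(1) unfolding r_def by linarith+
      have ln_s: "\<bar>ln s\<bar> \<ge> 1" "ln s < 0" using abs_ln_ge_1[of s] s s0 by auto
      have "ln r \<le> ln s" using r s by (subst ln_le_cancel_iff) auto
      then have "\<bar>ln s\<bar> powr \<alpha> \<le> l powr \<alpha>"
        using ln_s l \<alpha> by (intro powr_mono2) auto
      then have "1 / (s * l powr \<alpha>) \<le> 1 / (s * \<bar>ln s\<bar> powr \<alpha>)"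
        using s0 ln_s by (intro frac_le mult_left_mono) auto
      also have "\<dots> = omega_n \<alpha> n y"
        using s s0 by (simp add: omega_n_def omega_plus_def Bplus_def flip: s_def)
      finally have "1 / (s * l powr \<alpha>) * (1 / (2 * s)) \<le> omega_n \<alpha> n y * (snd y / s\<^sup>2)"
      proof (rule mult_mono)
        have "1 / (2 * s) = (s / 2) / s\<^sup>2" using s0 by (simp add: power2_eq_square)
        also have "\<dots> \<le> snd y / s\<^sup>2" using s by (intro divide_right_mono) auto
        finally show "1 / (2 * s) \<le> snd y / s\<^sup>2" .
      qed (use s0 omega_n_nonneg in auto)
      moreover have "g y = 1 / (s * l powr \<alpha>) * (1 / (2 * s))"
        using s True by (simp add: g_def c_def power2_eq_square flip: s_def)
      ultimately show ?thesis by (simp add: s_def)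
    next
      case False
      then have "g y = 0" by (auto simp: g_def)
      then show ?thesis using omega_n_mult_snd_nonneg[of \<alpha> n y] by simp
    qed
    have "(\<integral>\<^sup>+y. ennreal (g y) \<partial>lborel) = (\<integral>\<^sup>+y. ennreal c *
        (ennreal (1 / norm y ^ 2) * indicator {2 * r..1/4} (norm y) * indicator upper_sector y) \<partial>lborel)"
      unfolding g_def using c by (intro nn_integral_cong) (simp split: split_indicator flip: ennreal_mult)
    also have "\<dots> = ennreal c * (\<integral>\<^sup>+y.
        ennreal (1 / norm y ^ 2) * indicator {2 * r..1/4} (norm y) * indicator upper_sector y \<partial>lborel)"
      by (rule nn_integral_cmult) measurable
    also have "\<dots> = ennreal G"
      using r c unfolding G_def
      by (subst nn_integral_upper_sector_inverse_square) (auto simp flip: ennreal_mult')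
    finally show "(\<integral>\<^sup>+y. ennreal (g y) \<partial>lborel) = ennreal G" .
    have "ln (2 * r) \<le> ln (1/4)" using r by (subst ln_le_cancel_iff) auto
    then show "G \<ge> 0" unfolding G_def using c upper_sector_area_pos by simp
  qed
  moreover have "G \<ge> upper_sector_area / 2 * l powr (1 - \<alpha>)"
  proof -
    have "ln (1/4) - ln (2 * r) = l - (ln 4 + ln 2)"
      using r l by (simp add: ln_mult ln_div)
    also have "ln 4 + ln 2 = ln (8 :: real)" by (subst ln_mult_pos[symmetric]) auto
    finally have "ln (1/4) - ln (2 * r) \<ge> l / 2" using l8 by simp
    then have "c * (2 * upper_sector_area * (l / 2)) \<le> G"
      unfolding G_def using c upper_sector_area_pos by (intro mult_left_mono) auto
    moreover have "c * (2 * upper_sector_area * (l / 2)) = upper_sector_area / 2 * l powr (1 - \<alpha>)"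
      using l by (simp add: c_def powr_diff)
    ultimately show ?thesis by linarith
  qed
  ultimately show ?thesis by (simp add: l_def r_def)
qed

section \<open>Divergence of the velocity-vorticity integral\<close>

text \<open>For \<kappa> = 0 the Young function is the plain square, and \<kappa> < \<alpha> - 1/2
  becomes \<alpha> > 1/2.\<close>

lemma omega_plus_square_integrable:
  assumes "1/2 < \<alpha>"
  shows "integrable lborel (\<lambda>x. (omega_plus \<alpha> x)\<^sup>2)"
proof (rule integrableI_nonneg)
  have "A2k 0 s = s\<^sup>2" if "s \<ge> 0" for s using that by (simp add: A2k_def)
  then show "(\<integral>\<^sup>+x. ennreal ((omega_plus \<alpha> x)\<^sup>2) \<partial>lborel) < \<infinity>"
    using orlicz_modular_omega_plus_finite[of 0 \<alpha>] assms by (simp add: omega_plus_nonneg)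
qed auto

text \<open>The integrand is bounded below pointwise by a multiple of 1/(|x|^2 |ln |x||) on part of
  the sector, minus a multiple of the squared limit vorticity everywhere. Since
  \<open>omega_n\<close> is at most \<open>omega_plus\<close> almost everywhere, the subtracted
  integral is independent of \<open>n\<close>, and only the double logarithm grows.\<close>

lemma velocity_vorticity_integral_ge:
  assumes \<alpha>: "1/2 < \<alpha>" "\<alpha> \<le> 2/3" and n: "n \<ge> 128"
  shows "(\<integral>x. fst (BS_conv (omega_n \<alpha> n) x) * \<bar>omega_n \<alpha> n x\<bar>\<^sup>2 \<partial>lborel) \<ge>
     upper_sector_area / (4 * pi) * (2 * upper_sector_area * (ln (ln (real n / 2)) - ln (ln 64)))
     - 6 * unit_disk_area / pi * (\<integral>x. (omega_plus \<alpha> x)\<^sup>2 \<partial>lborel)"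
proof -
  define u where "u = (\<lambda>x. fst (BS_conv (omega_n \<alpha> n) x))"
  \<comment> \<open>The inner radius 2/n stays strictly outside the truncated disk, the outer one is
    the limit of validity of the sector estimate; n \<ge> 128 puts them in the right order.\<close>
  define h where "h = (\<lambda>x :: real \<times> real.
      1 / (norm x ^ 2 * \<bar>ln (norm x)\<bar>) * indicator {2 / real n..1/64} (norm x) * indicator upper_sector x)"
  let ?H = "2 * upper_sector_area * (ln (ln (real n / 2)) - ln (ln 64))"
  have n2: "0 < 2 / real n" "2 / real n \<le> 1/64" using n by (auto simp: field_simps)
  have h: "has_bochner_integral lborel h ?H"
  proof (rule has_bochner_integral_nn_integral)
    have "(\<integral>\<^sup>+x. ennreal (h x) \<partial>lborel) = (\<integral>\<^sup>+x. ennreal (1 / (norm x ^ 2 * \<bar>ln (norm x)\<bar>)) *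
        indicator {2 / real n..1/64} (norm x) * indicator upper_sector x \<partial>lborel)"
      unfolding h_def by (intro nn_integral_cong) (simp split: split_indicator)
    also have "\<dots> = ennreal (2 * upper_sector_area * (ln (- ln (2 / real n)) - ln (- ln (1/64))))"
      using n2 by (intro nn_integral_upper_sector_inverse_log) auto
    also have "- ln (2 / real n) = ln (real n / 2)" using n by (simp add: ln_div)
    also have "- ln (1/64) = ln (64::real)" by (simp add: ln_div)
    finally show "(\<integral>\<^sup>+x. ennreal (h x) \<partial>lborel) = ennreal ?H" .
    have "ln 64 \<le> ln (real n / 2)" using n by (subst ln_le_cancel_iff) auto
    moreover have "0 < ln (64 :: real)" by simp
    ultimately have "ln (ln 64) \<le> ln (ln (real n / 2))" by (subst ln_le_cancel_iff) linarith+
    then show "0 \<le> ?H" using upper_sector_area_pos by simp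
    show "AE x in lborel. 0 \<le> h x" by (simp add: h_def)
    show "h \<in> borel_measurable lborel" unfolding h_def by measurable
  qed
  have "\<alpha> \<ge> 0" "n \<ge> 2" using \<alpha> n by simp_all
  from omega_n_bounded[OF this]
  obtain M where M: "M \<ge> 0" "\<And>x. omega_n \<alpha> n x \<le> M * indicator (cball 0 (1/2)) x" by blast
  \<comment> \<open>The Bochner integral of a non-integrable function is 0 by convention, so
    integrability is needed before integrals can be compared.\<close>
  have int: "integrable lborel (\<lambda>x. u x * (omega_n \<alpha> n x)\<^sup>2)"
  proof (rule Bochner_Integration.integrable_bound)
    let ?C = "M / (2 * pi) * (2 * unit_disk_area * (1/2 + 1/2)) * M\<^sup>2"
    show "integrable lborel (\<lambda>x :: real \<times> real. ?C * indicator (cball 0 (1/2)) x)"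
      by (intro integrable_mult_right integrable_real_indicator emeasure_bounded_finite) auto
    have [measurable]: "(\<lambda>x. fst (BS_conv (omega_n \<alpha> n) x)) \<in> borel_measurable borel"
      by (rule measurable_compose[OF BS_conv_measurable[OF omega_n_measurable]])
         (intro borel_measurable_continuous_onI continuous_intros)
    show "(\<lambda>x. u x * (omega_n \<alpha> n x)\<^sup>2) \<in> borel_measurable lborel"
      unfolding u_def by measurable
    have "norm (u x * (omega_n \<alpha> n x)\<^sup>2) \<le> norm (?C * indicator (cball 0 (1/2)) x)" for x
    proof (cases "x \<in> cball 0 (1/2)")
      case True
      have "\<bar>u x\<bar> \<le> norm (BS_conv (omega_n \<alpha> n) x)"
        unfolding u_def using norm_fst_le[of "fst (BS_conv (omega_n \<alpha> n) x)" "snd (BS_conv (omega_n \<alpha> n) x)"] by simp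
      also have "\<dots> \<le> M / (2 * pi) * (2 * unit_disk_area * (1/2 + norm x))"
        by (rule norm_BS_conv_le[OF omega_n_measurable omega_n_nonneg M(2)])
      also have "\<dots> \<le> M / (2 * pi) * (2 * unit_disk_area * (1/2 + 1/2))"
        using True M unit_disk_area_nonneg by (intro mult_left_mono add_left_mono) auto
      finally have u_le: "\<bar>u x\<bar> \<le> M / (2 * pi) * (2 * unit_disk_area * (1/2 + 1/2))" .
      have "(omega_n \<alpha> n x)\<^sup>2 \<le> M\<^sup>2"
        using M(2)[of x] True omega_n_nonneg[of \<alpha> n x] by (intro power_mono) simp_all
      with u_le have "\<bar>u x\<bar> * (omega_n \<alpha> n x)\<^sup>2 \<le> ?C"
        by (rule mult_mono) (use M unit_disk_area_nonneg in simp_all)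
      then show ?thesis using True M unit_disk_area_nonneg by (simp add: abs_mult)
    next
      case False
      then show ?thesis using M(2)[of x] omega_n_nonneg[of \<alpha> n x] by simp
    qed
    then show "AE x in lborel. norm (u x * (omega_n \<alpha> n x)\<^sup>2) \<le> norm (?C * indicator (cball 0 (1/2)) x)"
      by simp
  qed
  let ?b = "\<lambda>x. upper_sector_area / (4 * pi) * h x - 6 * unit_disk_area / pi * (omega_plus \<alpha> x)\<^sup>2"
  have pointwise: "?b x \<le> u x * (omega_n \<alpha> n x)\<^sup>2" if x: "snd x \<noteq> 0" for x
  proof -
    have "omega_n \<alpha> n x \<le> omega_plus \<alpha> x"
      using \<alpha> n x by (intro omega_n_le_omega_plus) auto
    then have "(omega_n \<alpha> n x)\<^sup>2 \<le> (omega_plus \<alpha> x)\<^sup>2"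
      using omega_n_nonneg by (intro power_mono) auto
    then have le: "6 * unit_disk_area / pi * (omega_n \<alpha> n x)\<^sup>2 \<le> 6 * unit_disk_area / pi * (omega_plus \<alpha> x)\<^sup>2"
      using unit_disk_area_nonneg by (intro mult_left_mono) auto
    show ?thesis
    proof (cases "norm x \<in> {2 / real n..1/64} \<and> x \<in> upper_sector")
      case True
      define l where "l = \<bar>ln (norm x)\<bar>"
      have nx: "2 / real n \<le> norm x" "norm x \<le> 1/64" "norm x \<le> 2 * snd x"
        using True by (auto simp: upper_sector_def)
      have "1 / real n < 2 / real n" using n by (simp add: field_simps)
      then have nx1: "1 / real n < norm x" "norm x > 0" using nx n2 by linarith+
      have l: "l \<ge> 1" using abs_ln_ge_1[of "norm x"] nx nx1 by (auto simp: l_def)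
      have om: "omega_n \<alpha> n x = 1 / (norm x * l powr \<alpha>)"
      proof -
        have "snd x > 0" using nx(3) nx1(2) by linarith
        moreover from this have "x \<in> Bplus" "\<not> snd x < 0" using nx(2) by (simp_all add: Bplus_def)
        ultimately show ?thesis
          by (simp only: omega_n_def omega_plus_def l_def nx1(1) if_True if_False)
      qed
      have "2 * pi * u x \<ge> upper_sector_area / 2 * l powr (1 - \<alpha>) - 12 * unit_disk_area"
        unfolding u_def l_def
        using \<alpha> n by (intro fst_BS_conv_omega_n_sector_ge[OF _ _ _ nx1(1) nx(2)]) simp_all
      then have "u x \<ge> upper_sector_area / (4 * pi) * l powr (1 - \<alpha>) - 6 * unit_disk_area / pi"
        by (simp add: field_simps)
      then have "(upper_sector_area / (4 * pi) * l powr (1 - \<alpha>) - 6 * unit_disk_area / pi) * (omega_n \<alpha> n x)\<^sup>2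
          \<le> u x * (omega_n \<alpha> n x)\<^sup>2" by (intro mult_right_mono) auto
      moreover have "upper_sector_area / (4 * pi) * h x \<le>
          upper_sector_area / (4 * pi) * (l powr (1 - \<alpha>) * (omega_n \<alpha> n x)\<^sup>2)"
      proof (rule mult_left_mono)
        have "h x = l powr (-1) / norm x ^ 2" using True l by (simp add: h_def powr_minus_divide flip: l_def)
        \<comment> \<open>Here \<alpha> \<le> 2/3 enters: it gives 1 - 3 \<alpha> \<ge> -1, and l
          \<ge> 1. The exponent combines 1 - \<alpha> from the velocity with -2 \<alpha> from the
          squared vorticity.\<close>
        also have "\<dots> \<le> l powr (1 - 3 * \<alpha>) / norm x ^ 2"
          using l \<alpha> by (intro divide_right_mono powr_mono) auto
        also have "l powr (1 - 3 * \<alpha>) = l powr (1 - \<alpha>) / l powr (\<alpha> * 2)"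
          by (simp flip: powr_diff)
        also have "l powr (1 - \<alpha>) / l powr (\<alpha> * 2) / norm x ^ 2 = l powr (1 - \<alpha>) * (omega_n \<alpha> n x)\<^sup>2"
          unfolding om using l by (simp add: power_divide power_mult_distrib powr_power mult.commute)
        finally show "h x \<le> l powr (1 - \<alpha>) * (omega_n \<alpha> n x)\<^sup>2" .
      qed (use upper_sector_area_pos in auto)
      ultimately show ?thesis using le by (simp add: left_diff_distrib mult.assoc)
    next
      case False
      then have "h x = 0" by (auto simp: h_def)
      have "2 * pi * u x \<ge> - 12 * unit_disk_area"
        unfolding u_def using \<alpha> n x by (intro fst_BS_conv_omega_n_ge) auto
      then have "- (6 * unit_disk_area / pi) \<le> u x" by (simp add: field_simps)
      then have "- (6 * unit_disk_area / pi) * (omega_n \<alpha> n x)\<^sup>2 \<le> u x * (omega_n \<alpha> n x)\<^sup>2"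
        by (intro mult_right_mono) auto
      then show ?thesis using le \<open>h x = 0\<close> by simp
    qed
  qed
  have "(\<integral>x. ?b x \<partial>lborel) \<le> (\<integral>x. u x * (omega_n \<alpha> n x)\<^sup>2 \<partial>lborel)"
  proof (rule integral_mono_AE)
    show "integrable lborel ?b"
      using h omega_plus_square_integrable[OF \<alpha>(1)]
      by (intro Bochner_Integration.integrable_diff integrable_mult_right) (auto simp: has_bochner_integral_iff)
    show "AE x in lborel. ?b x \<le> u x * (omega_n \<alpha> n x)\<^sup>2"
      using AE_lborel_snd_nonzero pointwise by (auto elim!: eventually_mono)
  qed (rule int)
  also have "(\<integral>x. ?b x \<partial>lborel) = upper_sector_area / (4 * pi) * ?H
     - 6 * unit_disk_area / pi * (\<integral>x. (omega_plus \<alpha> x)\<^sup>2 \<partial>lborel)"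
    using h omega_plus_square_integrable[OF \<alpha>(1)]
    by (subst Bochner_Integration.integral_diff) (auto simp: has_bochner_integral_iff)
  finally show ?thesis unfolding u_def by simp
qed

theorem theorem5p4:
  fixes \<alpha> :: real
  assumes "1/2 < \<alpha>" and "\<alpha> \<le> 2/3"
  shows "(\<forall>\<kappa>::real. 0 \<le> \<kappa> \<and> \<kappa> < \<alpha> - 1/2 \<longrightarrow>
            in_L2logL \<kappa> (omega_plus \<alpha>)
          \<and> (\<forall>n::nat. n \<ge> 2 \<longrightarrow> in_L2logL \<kappa> (omega_n \<alpha> n))
          \<and> ((\<lambda>n. lux_norm \<kappa> (\<lambda>x. omega_n \<alpha> n x - omega_plus \<alpha> x)) \<longlonglongrightarrow> 0))
       \<and> filterlim (\<lambda>n::nat. \<integral>x. fst (BS_conv (omega_n \<alpha> n) x) * \<bar>omega_n \<alpha> n x\<bar>\<^sup>2 \<partial>lborel)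
                   at_top sequentially"
proof (intro conjI allI impI)
  fix \<kappa> :: real assume "0 \<le> \<kappa> \<and> \<kappa> < \<alpha> - 1/2"
  then have \<kappa>: "0 \<le> \<kappa>" "\<kappa> < \<alpha> - 1/2" by auto
  show "in_L2logL \<kappa> (omega_plus \<alpha>)" using \<kappa> assms by (intro in_L2logL_omega_plus) auto
  show "in_L2logL \<kappa> (omega_n \<alpha> n)" if "n \<ge> 2" for n
    using \<kappa> assms that by (intro in_L2logL_omega_n) auto
  show "(\<lambda>n. lux_norm \<kappa> (\<lambda>x. omega_n \<alpha> n x - omega_plus \<alpha> x)) \<longlonglongrightarrow> 0"
    using \<kappa> assms by (intro lux_norm_omega_diff_tendsto) auto
next
  let ?c = "upper_sector_area / (4 * pi) * (2 * upper_sector_area)"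
  \<comment> \<open>All terms of the lower bound that do not depend on \<open>n\<close>.\<close>
  let ?d = "?c * (- ln (ln 64)) - 6 * unit_disk_area / pi * (\<integral>x. (omega_plus \<alpha> x)\<^sup>2 \<partial>lborel)"
  have c: "?c > 0" using upper_sector_area_pos by simp
  have "filterlim (\<lambda>n. real n * (1/2)) at_top sequentially"
    by (rule filterlim_at_top_mult_tendsto_pos[OF tendsto_const _ filterlim_real_sequentially]) simp
  then have "filterlim (\<lambda>n. ln (ln (real n * (1/2)))) at_top sequentially"
    by (intro filterlim_compose[OF ln_at_top])
  then have "filterlim (\<lambda>n. ?c * ln (ln (real n * (1/2)))) at_top sequentially"
    by (rule filterlim_tendsto_pos_mult_at_top[OF tendsto_const c])
  then have lim: "filterlim (\<lambda>n. ?d + ?c * ln (ln (real n * (1/2)))) at_top sequentially"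
    by (rule filterlim_tendsto_add_at_top[OF tendsto_const])
  show "filterlim (\<lambda>n::nat. \<integral>x. fst (BS_conv (omega_n \<alpha> n) x) * \<bar>omega_n \<alpha> n x\<bar>\<^sup>2 \<partial>lborel)
                   at_top sequentially"
  proof (rule filterlim_at_top_mono[OF lim])
    show "eventually (\<lambda>n. ?d + ?c * ln (ln (real n * (1/2))) \<le>
        (\<integral>x. fst (BS_conv (omega_n \<alpha> n) x) * \<bar>omega_n \<alpha> n x\<bar>\<^sup>2 \<partial>lborel)) sequentially"
    proof (rule eventually_sequentiallyI[of 128])
      fix n :: nat assume "128 \<le> n"
      from velocity_vorticity_integral_ge[OF assms this]
      show "?d + ?c * ln (ln (real n * (1/2))) \<le>
          (\<integral>x. fst (BS_conv (omega_n \<alpha> n) x) * \<bar>omega_n \<alpha> n x\<bar>\<^sup>2 \<partial>lborel)"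
        by (simp add: right_diff_distrib)
    qed
  qed
qed

end
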